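(* Let $\mathcal{C}=\mathcal{C}(\beta)$ or $\mathcal{C}(Q)$, where $\beta$ is a non-degenerate alternating, hermitian or symmetric form, respectively $Q$ a non-singular quadratic form, on a finite-dimensional vector space $V$ over $F$. A complete set of representatives for the conjugacy classes of $\mathcal{C}$ is described by all pairs of matrices $(SU,B)$, defined by $$S=\begin{pmatrix}S_1&&\\&\ddots&\\&&S_h\end{pmatrix},\quad U=\begin{pmatrix}U_{1,j}&&\\&\ddots&\\&&U_{h,j}\end{pmatrix},\quad B=\begin{pmatrix}B_1&&\\&\ddots&\\&&B_h\end{pmatrix},$$ where $(S,B)$ runs over all representatives of the semisimple conjugacy classes of $\mathcal{C}$ (one pair for each class, in the block form described in the context) and, for every such $(S,B)$, $U_{i,j}$ runs (independently for each $i=1,\dots,h$) over all representatives of the unipotent conjugacy classes of $C_{\mathcal{C}(B_i)}(S_i)$.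
   Context: $F=\mathbb{F}_{q^2}$ with $\overline\lambda=\lambda^q$ in the hermitian case, $F=\mathbb{F}_q$ with $\overline\lambda=\lambda$ otherwise; $A^*=\overline A^{\mathrm t}$; row vectors are used. $\mathcal{C}(B)$ is the isometry group of the form with matrix $B$ (Gram matrix for a sesquilinear form; a matrix with $Q(v)=vBv^{\mathrm t}$ for a quadratic form). Semisimple: order coprime to the characteristic $p$; unipotent: order a power of $p$. The unipotent conjugacy classes of a subgroup $H\le\mathrm{GL}$ are the $H$-conjugacy classes of its unipotent elements. Pairs: conjugacy classes of $\mathcal{C}$ are described by pairs $(X,B)$, where $B$ is the matrix of a form congruent to the one defining $\mathcal{C}$ and $X\in\mathcal{C}(B)$. If $B_0$ is the matrix of the form defining $\mathcal{C}$ and $P\in\mathrm{GL}(V)$ satisfies $PB_0P^*=B$ (in the quadratic case, $PB_0P^{\mathrm t}-B$ alternating), then $(X,B)$ represents the $\mathcal{C}$-class of $P^{-1}XP$; this class does not depend on $P$. Polynomials: for monic $f$ of degree $d$ with $f(0)\neq0$, $f^*(t)=\overline{f(0)}^{-1}t^d\overline f(t^{-1})$. $\Phi_1$: monic irreducible $f=f^*$ of degree 1; $\Phi_2$: $f=gg^*$ with $g\ne g^*$ monic irreducible; $\Phi_3$: monic irreducible $f=f^*$ with $\deg f>1$; $\Phi=\Phi_1\cup\Phi_2\cup\Phi_3$. For $S\in\mathcal{C}$ semisimple, its generalized elementary divisors are the distinct $f_1,\dots,f_h\in\Phi$ whose product is the minimal polynomial of $S$. The pairs $(S,B)$ are chosen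 in a basis adapted to the decomposition $V=\bigoplus_i\ker f_i(S)$, so that $S=\mathrm{diag}(S_1,\dots,S_h)$ and $B=\mathrm{diag}(B_1,\dots,B_h)$, where $S_i$ and $B_i$ are the matrices of the restrictions of $S$ and of the form to $\ker f_i(S)$. *)

theory Defs
  imports
    "HOL-Algebra.Multiplicative_Group"
    "HOL-Computational_Algebra.Computational_Algebra"
    "HOL-Library.Cardinality"
    "Jordan_Normal_Form.Matrix"
begin

text \<open>
  The space \<open>V\<close> is \<open>F\<^sup>n\<close>; vectors are rows, i.e. \<open>1 \<times> n\<close> matrices, and matrices act
  on the right. Forms are given by their matrices.
\<close>

datatype form_type = Alternating | Hermitian | Symmetric | Quadratic

abbreviation rows_space :: "nat \<Rightarrow> 'a mat set" where
  "rows_space n \<equiv> carrier_mat 1 n"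

definition GL :: "nat \<Rightarrow> 'a::field mat monoid" where
  "GL n = units_of (ring_mat TYPE('a) n ())"

definition mat_inv :: "'a::field mat \<Rightarrow> 'a mat" where
  "mat_inv A = inv\<^bsub>GL (dim_row A)\<^esub> A"

definition mat_order :: "'a::field mat \<Rightarrow> nat" where
  "mat_order A = group.ord (GL (dim_row A)) A"

definition semisimple :: "'a::field mat \<Rightarrow> bool" where
  "semisimple A \<longleftrightarrow> coprime (mat_order A) CHAR('a)"

definition unipotent :: "'a::field mat \<Rightarrow> bool" where
  "unipotent A \<longleftrightarrow> (\<exists>k. mat_order A = CHAR('a) ^ k)"


section \<open>Forms and their isometry groups\<close>

definition bar :: "form_type \<Rightarrow> nat \<Rightarrow> 'a::field \<Rightarrow> 'a" where
  "bar \<kappa> q x = (if \<kappa> = Hermitian then x ^ q else x)"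

definition star :: "form_type \<Rightarrow> nat \<Rightarrow> 'a::field mat \<Rightarrow> 'a mat" where
  "star \<kappa> q A = map_mat (bar \<kappa> q) (transpose_mat A)"

definition sesq :: "form_type \<Rightarrow> nat \<Rightarrow> 'a::field mat \<Rightarrow> 'a mat \<Rightarrow> 'a mat \<Rightarrow> 'a" where
  "sesq \<kappa> q B u v = (u * B * star \<kappa> q v) $$ (0, 0)"

definition quad :: "'a::field mat \<Rightarrow> 'a mat \<Rightarrow> 'a" where
  "quad B v = (v * B * transpose_mat v) $$ (0, 0)"

definition polar :: "'a::field mat \<Rightarrow> 'a mat \<Rightarrow> 'a mat \<Rightarrow> 'a" where
  "polar B u v = quad B (u + v) - quad B u - quad B v"

definition nondegenerate :: "form_type \<Rightarrow> nat \<Rightarrow> nat \<Rightarrow> 'a::field mat \<Rightarrow> bool" where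
  "nondegenerate \<kappa> q n B \<longleftrightarrow>
     (\<forall>u\<in>rows_space n. (\<forall>v\<in>rows_space n. sesq \<kappa> q B u v = 0) \<longrightarrow> u = 0\<^sub>m 1 n)"

text \<open>
  Non-singularity of a quadratic form means that it does not vanish at any non-zero vector of
  the radical of its polar form. The radical itself may be non-zero, which happens precisely in
  characteristic 2 and odd dimension.
\<close>

definition nonsingular :: "nat \<Rightarrow> 'a::field mat \<Rightarrow> bool" where
  "nonsingular n B \<longleftrightarrow>
     (\<forall>u\<in>rows_space n. (\<forall>v\<in>rows_space n. polar B u v = 0) \<and> quad B u = 0 \<longrightarrow> u = 0\<^sub>m 1 n)"

definition classical_form :: "form_type \<Rightarrow> nat \<Rightarrow> nat \<Rightarrow> 'a::field mat \<Rightarrow> bool" where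
  "classical_form \<kappa> q n B \<longleftrightarrow> B \<in> carrier_mat n n \<and>
     (case \<kappa> of
        Alternating \<Rightarrow> nondegenerate \<kappa> q n B \<and> (\<forall>v\<in>rows_space n. sesq \<kappa> q B v v = 0)
      | Hermitian \<Rightarrow> nondegenerate \<kappa> q n B \<and>
          (\<forall>u\<in>rows_space n. \<forall>v\<in>rows_space n. sesq \<kappa> q B v u = bar \<kappa> q (sesq \<kappa> q B u v))
      | Symmetric \<Rightarrow> nondegenerate \<kappa> q n B \<and>
          (\<forall>u\<in>rows_space n. \<forall>v\<in>rows_space n. sesq \<kappa> q B v u = sesq \<kappa> q B u v)
      | Quadratic \<Rightarrow> nonsingular n B)"

definition isom_group :: "form_type \<Rightarrow> nat \<Rightarrow> 'a::field mat \<Rightarrow> 'a mat set" where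
  "isom_group \<kappa> q B =
     (let n = dim_row B in
      {X \<in> carrier (GL n).
         if \<kappa> = Quadratic then \<forall>v\<in>rows_space n. quad B (v * X) = quad B v
         else \<forall>u\<in>rows_space n. \<forall>v\<in>rows_space n.
                sesq \<kappa> q B (u * X) (v * X) = sesq \<kappa> q B u v})"

definition alternating_mat :: "'a::field mat \<Rightarrow> bool" where
  "alternating_mat A \<longleftrightarrow> transpose_mat A = - A \<and> (\<forall>i<dim_row A. A $$ (i, i) = 0)"

definition congruent_via ::
    "form_type \<Rightarrow> nat \<Rightarrow> 'a::field mat \<Rightarrow> 'a mat \<Rightarrow> 'a mat \<Rightarrow> bool" where
  "congruent_via \<kappa> q P B\<^sub>0 B \<longleftrightarrow>
     P \<in> carrier (GL (dim_row B\<^sub>0)) \<and> B \<in> carrier_mat (dim_row B\<^sub>0) (dim_row B\<^sub>0) \<and>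
     (if \<kappa> = Quadratic then alternating_mat (P * B\<^sub>0 * transpose_mat P - B)
      else P * B\<^sub>0 * star \<kappa> q P = B)"


section \<open>Conjugacy classes and their representatives\<close>

definition conj_class :: "'a::field mat set \<Rightarrow> 'a mat \<Rightarrow> 'a mat set" where
  "conj_class H X = {mat_inv Z * X * Z | Z. Z \<in> H}"

definition centralizer :: "'a::field mat set \<Rightarrow> 'a mat \<Rightarrow> 'a mat set" where
  "centralizer H S = {X \<in> H. X * S = S * X}"

definition unipotent_class_reps :: "'a::field mat set \<Rightarrow> 'a mat set \<Rightarrow> bool" where
  "unipotent_class_reps H R \<longleftrightarrow>
     R \<subseteq> {X \<in> H. unipotent X} \<and>
     bij_betw (conj_class H) R {conj_class H X | X. X \<in> H \<and> unipotent X}"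

text \<open>
  The conjugacy class of \<open>C(B\<^sub>0)\<close> represented by a pair \<open>(X, B)\<close>. The members of the union
  coincide for all \<open>P\<close> when \<open>X \<in> C(B)\<close>.
\<close>

definition pair_class ::
    "form_type \<Rightarrow> nat \<Rightarrow> 'a::field mat \<Rightarrow> 'a mat \<times> 'a mat \<Rightarrow> 'a mat set" where
  "pair_class \<kappa> q B\<^sub>0 = (\<lambda>(X, B).
     \<Union>P\<in>{P. congruent_via \<kappa> q P B\<^sub>0 B}. conj_class (isom_group \<kappa> q B\<^sub>0) (mat_inv P * X * P))"

definition form_pairs :: "form_type \<Rightarrow> nat \<Rightarrow> 'a::field mat \<Rightarrow> ('a mat \<times> 'a mat) set" where
  "form_pairs \<kappa> q B\<^sub>0 =
     {(X, B). (\<exists>P. congruent_via \<kappa> q P B\<^sub>0 B) \<and> X \<in> isom_group \<kappa> q B}"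

text \<open>
  \<open>R\<close> contains exactly one pair for each conjugacy class of \<open>C(B\<^sub>0)\<close> whose elements have the
  (conjugation-invariant) property \<open>E\<close>.
\<close>

definition complete_pair_reps ::
    "form_type \<Rightarrow> nat \<Rightarrow> 'a::field mat \<Rightarrow> ('a mat \<Rightarrow> bool) \<Rightarrow> ('a mat \<times> 'a mat) set \<Rightarrow> bool" where
  "complete_pair_reps \<kappa> q B\<^sub>0 E R \<longleftrightarrow>
     R \<subseteq> form_pairs \<kappa> q B\<^sub>0 \<and>
     bij_betw (pair_class \<kappa> q B\<^sub>0) R
       {conj_class (isom_group \<kappa> q B\<^sub>0) X | X. X \<in> isom_group \<kappa> q B\<^sub>0 \<and> E X}"


section \<open>Generalized elementary divisors and adapted block forms\<close>

text \<open>\<open>reflect_poly f\<close> is \<open>t\<^sup>d f(t\<^sup>-\<^sup>1)\<close> with \<open>d = degree f\<close>.\<close>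

definition poly_star :: "form_type \<Rightarrow> nat \<Rightarrow> 'a::field poly \<Rightarrow> 'a poly" where
  "poly_star \<kappa> q f =
     smult (inverse (bar \<kappa> q (poly f 0))) (reflect_poly (map_poly (bar \<kappa> q) f))"

definition star_irreducible :: "'a::field poly \<Rightarrow> bool" where
  "star_irreducible f \<longleftrightarrow>
     lead_coeff f = 1 \<and> Factorial_Ring.irreducible f \<and> poly f 0 \<noteq> 0"

definition Phi1 :: "form_type \<Rightarrow> nat \<Rightarrow> 'a::field poly set" where
  "Phi1 \<kappa> q = {f. star_irreducible f \<and> poly_star \<kappa> q f = f \<and> Polynomial.degree f = 1}"

definition Phi2 :: "form_type \<Rightarrow> nat \<Rightarrow> 'a::field poly set" where
  "Phi2 \<kappa> q = {g * poly_star \<kappa> q g | g. star_irreducible g \<and> g \<noteq> poly_star \<kappa> q g}"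

definition Phi3 :: "form_type \<Rightarrow> nat \<Rightarrow> 'a::field poly set" where
  "Phi3 \<kappa> q = {f. star_irreducible f \<and> poly_star \<kappa> q f = f \<and> Polynomial.degree f > 1}"

definition Phi :: "form_type \<Rightarrow> nat \<Rightarrow> 'a::field poly set" where
  "Phi \<kappa> q = Phi1 \<kappa> q \<union> Phi2 \<kappa> q \<union> Phi3 \<kappa> q"

definition poly_at_mat :: "'a::field poly \<Rightarrow> 'a mat \<Rightarrow> 'a mat" where
  "poly_at_mat p A = mat (dim_row A) (dim_row A)
     (\<lambda>(r, c). \<Sum>i\<le>Polynomial.degree p. Polynomial.coeff p i * (A ^\<^sub>m i) $$ (r, c))"

definition is_minimal_poly :: "'a::field mat \<Rightarrow> 'a poly \<Rightarrow> bool" where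
  "is_minimal_poly A m \<longleftrightarrow>
     lead_coeff m = 1 \<and> poly_at_mat m A = 0\<^sub>m (dim_row A) (dim_row A) \<and>
     (\<forall>p. poly_at_mat p A = 0\<^sub>m (dim_row A) (dim_row A) \<longrightarrow> m dvd p)"

definition generalized_elementary_divisors ::
    "form_type \<Rightarrow> nat \<Rightarrow> 'a::field mat \<Rightarrow> 'a poly list \<Rightarrow> bool" where
  "generalized_elementary_divisors \<kappa> q S fs \<longleftrightarrow>
     distinct fs \<and> set fs \<subseteq> Phi \<kappa> q \<and> is_minimal_poly S (prod_list fs)"

definition row_kernel :: "'a::field mat \<Rightarrow> 'a mat set" where
  "row_kernel A = {v \<in> rows_space (dim_row A). v * A = 0\<^sub>m 1 (dim_col A)}"

text \<open>The rows of \<open>V\<close> supported on the coordinates of the \<open>i\<close>-th diagonal block.\<close>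

definition block_space :: "'a::field mat list \<Rightarrow> nat \<Rightarrow> 'a mat set" where
  "block_space As i =
     {v \<in> rows_space (sum_list (map dim_row As)).
        \<forall>j < sum_list (map dim_row As).
          v $$ (0, j) \<noteq> 0 \<longrightarrow>
            sum_list (map dim_row (take i As)) \<le> j \<and>
            j < sum_list (map dim_row (take (Suc i) As))}"

text \<open>
  The blocks of \<open>(S, B)\<close> with respect to a basis adapted to the decomposition of \<open>V\<close> into the
  kernels of the \<open>f\<^sub>i(S)\<close>; as that basis is the standard one, each block is the matrix of the
  restriction of \<open>S\<close>, respectively of the form, to \<open>ker f\<^sub>i(S)\<close>.
\<close>

definition adapted_blocks ::
    "form_type \<Rightarrow> nat \<Rightarrow> 'a::field mat \<times> 'a mat \<Rightarrow> 'a mat list \<Rightarrow> 'a mat list \<Rightarrow> bool" where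
  "adapted_blocks \<kappa> q = (\<lambda>(S, B) Ss Bs.
     length Bs = length Ss \<and>
     (\<forall>i<length Ss. square_mat (Ss ! i) \<and> square_mat (Bs ! i) \<and> dim_row (Bs ! i) = dim_row (Ss ! i)) \<and>
     S = diag_block_mat Ss \<and> B = diag_block_mat Bs \<and>
     (\<exists>fs. generalized_elementary_divisors \<kappa> q S fs \<and> length fs = length Ss \<and>
        (\<forall>i<length Ss. row_kernel (poly_at_mat (fs ! i) S) = block_space Ss i)))"

end

theory Submission
  imports Defs "HOL-Algebra.Sylow" "HOL-Number_Theory.Cong" "Jordan_Normal_Form.Determinant"
begin

text \<open>
  Every isometry \<open>X\<close> is uniquely a product \<open>S * U\<close> of commuting isometries with \<open>S\<close> semisimple and
  \<open>U\<close> unipotent, both being powers of \<open>X\<close>. By uniqueness, the class of \<open>X\<close> determines the class of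
  \<open>S\<close> and, once \<open>S\<close> is fixed, the class of \<open>U\<close> in the centralizer of \<open>S\<close>, and conversely. A matrix
  commuting with \<open>S\<close> preserves the kernels of the \<open>f\<^sub>i(S)\<close>, so in an adapted basis it is block
  diagonal; as the form is block diagonal as well, the centralizer is the direct product of the
  centralizers of the \<open>S\<^sub>i\<close> in \<open>C(B\<^sub>i)\<close>, and its unipotent classes are products of unipotent classes.
\<close>

section \<open>Decomposition of group elements into commuting parts of coprime order\<close>

text \<open>Semisimple and unipotent are conditions on the multiplicative order, so the
  decomposition is a fact about an element of a finite group and a prime, with exponents from the
  Chinese remainder theorem. Two obstacles shape the rest. First, a representative carries its own
  form \<open>B\<close>, in general different from \<open>B\<^sub>0\<close>, so conjugacy has to be
  expressed between elements of different groups. It is therefore written as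
  \<open>Q * Y = X * Q\<close> with \<open>Q\<close> an isometry between the two forms; such
  equations compose and pass to powers and products without any cancelling of inverses. Second, a
  quadratic form determines its matrix only up to an alternating summand, so congruence is then not
  an equation of matrices. Comparing values of forms instead lets one argument serve all four
  types.\<close>

context group
begin

text \<open>This is the passage from classes to intertwining equations: with \<open>z\<close> moved
  to both sides, such equations can be chained, multiplied and raised to powers.\<close>

lemma conj_set_eq_iff:
  assumes "subgroup H G" "x \<in> carrier G" "y \<in> carrier G"
  shows "{inv z \<otimes> x \<otimes> z | z. z \<in> H} = {inv z \<otimes> y \<otimes> z | z. z \<in> H} \<longleftrightarrow> (\<exists>z\<in>H. z \<otimes> y = x \<otimes> z)"
    (is "?C x = ?C y \<longleftrightarrow> ?R")
proof
  assume eq: "?C x = ?C y"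
  have "y \<in> ?C y"
    using assms subgroup.one_closed[OF assms(1)] by (auto intro!: exI[of _ \<one>])
  then obtain z where z: "z \<in> H" "y = inv z \<otimes> x \<otimes> z" using eq by blast
  then have "z \<in> carrier G" using assms(1) subgroup.mem_carrier by metis
  then have "z \<otimes> y = x \<otimes> z"
    using z assms by (simp add: m_assoc[symmetric])
  with z show ?R by blast
next
  assume ?R
  then obtain w where w: "w \<in> H" "w \<otimes> y = x \<otimes> w" by blast
  have wc: "w \<in> carrier G" using assms(1) w subgroup.mem_carrier by metis
  have x: "x = w \<otimes> y \<otimes> inv w" using w wc assms by (simp add: inv_solve_right m_assoc)
  have y: "y = inv w \<otimes> x \<otimes> w" using w wc assms by (simp add: inv_solve_left m_assoc)
  show "?C x = ?C y"
  proof (intro equalityI subsetI)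
    fix a assume "a \<in> ?C x"
    then obtain z where z: "z \<in> H" "a = inv z \<otimes> x \<otimes> z" by blast
    have zc: "z \<in> carrier G" using assms(1) z subgroup.mem_carrier by metis
    have "inv (inv w \<otimes> z) \<otimes> y \<otimes> (inv w \<otimes> z) = a"
      using z zc wc assms by (simp add: x inv_mult_group m_assoc)
    moreover have "inv w \<otimes> z \<in> H"
      using assms(1) w z by (simp add: subgroup.m_closed subgroup.m_inv_closed)
    ultimately show "a \<in> ?C y" by blast
  next
    fix a assume "a \<in> ?C y"
    then obtain z where z: "z \<in> H" "a = inv z \<otimes> y \<otimes> z" by blast
    have zc: "z \<in> carrier G" using assms(1) z subgroup.mem_carrier by metis
    have "inv (w \<otimes> z) \<otimes> x \<otimes> (w \<otimes> z) = a"
      unfolding z(2) using zc wc assms by (subst y) (simp add: inv_mult_group m_assoc)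
    moreover have "w \<otimes> z \<in> H"
      using assms(1) w z by (simp add: subgroup.m_closed)
    ultimately show "a \<in> ?C x" by blast
  qed
qed

lemma pow_cong:
  assumes "x \<in> carrier G" "x [^] m = \<one>" "[a = b] (mod m)"
  shows "x [^] a = x [^] (b::nat)"
proof -
  have "x [^] c = x [^] (c mod m)" for c :: nat
  proof -
    have "x [^] c = x [^] (m * (c div m)) \<otimes> x [^] (c mod m)"
      using assms(1) by (simp add: nat_pow_mult)
    then show ?thesis
      using assms(1,2) by (simp flip: nat_pow_pow)
  qed
  then show ?thesis using assms(3) unfolding cong_def by metis
qed

lemma intertwine_pow:
  assumes "x \<in> carrier G" "y \<in> carrier G" "z \<in> carrier G" "z \<otimes> y = x \<otimes> z"
  shows "z \<otimes> y [^] (k::nat) = x [^] k \<otimes> z"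
proof (induction k)
  case (Suc k)
  have "z \<otimes> y [^] Suc k = (z \<otimes> y [^] k) \<otimes> y" using assms by (simp add: m_assoc)
  also have "\<dots> = x [^] k \<otimes> (z \<otimes> y)" using assms Suc by (simp add: m_assoc)
  also have "\<dots> = x [^] Suc k \<otimes> z" using assms by (simp add: m_assoc)
  finally show ?case .
qed (use assms in auto)

lemma intertwine_pow_one:
  assumes "x \<in> carrier G" "y \<in> carrier G" "z \<in> carrier G" "z \<otimes> y = x \<otimes> z"
    and "x [^] k = \<one>"
  shows "y [^] (k::nat) = \<one>"
proof -
  have "z \<otimes> y [^] k = z" using intertwine_pow[OF assms(1-4), of k] assms(3,5) by simp
  then show ?thesis using assms(2,3) by simp
qed

text \<open>Write \<open>ord x = p ^ k * m\<close> with \<open>m\<close> prime to \<open>p\<close>.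
  The Chinese remainder theorem supplies two complementary exponents: \<open>a\<close> is 1 modulo
  \<open>m\<close> and 0 modulo \<open>p ^ k\<close>, and \<open>b\<close> is the reverse. Their sum
  is 1 modulo the order, so the two powers multiply to \<open>x\<close>.\<close>

lemma ex_p_part_decomposition:
  assumes "finite (carrier G)" "x \<in> carrier G" "prime p"
  obtains a b m k :: nat where "coprime m p" "(x [^] a) [^] m = \<one>" "(x [^] b) [^] (p ^ k) = \<one>"
    "x [^] a \<otimes> x [^] b = x"
proof -
  have "ord x \<noteq> 0" using ord_ge_1[OF assms(1,2)] by simp
  then obtain m where m: "ord x = p ^ multiplicity p (ord x) * m" "\<not> p dvd m"
    using assms(3) multiplicity_decompose'[of "ord x" p] by (metis not_prime_unit)
  define k where "k = multiplicity p (ord x)"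
  have cp: "coprime m p" using m(2) assms(3) by (metis coprime_commute prime_imp_coprime)
  then have cpk: "coprime m (p ^ k)" by simp
  obtain a where a: "[a = 1] (mod m)" "[a = 0] (mod p ^ k)"
    using binary_chinese_remainder_nat[OF cpk] by metis
  obtain b where b: "[b = 0] (mod m)" "[b = 1] (mod p ^ k)"
    using binary_chinese_remainder_nat[OF cpk] by metis
  have o: "x [^] (m * p ^ k) = \<one>" using m(1) assms(2) by (metis k_def mult.commute pow_ord_eq_1)
  have "x [^] (a * m) = \<one>"
    using a(2) m(1) assms(2) pow_eq_id[OF assms(2)]
    by (metis cong_0_iff k_def mult_dvd_mono dvd_refl)
  moreover have "x [^] (b * p ^ k) = \<one>"
    using b(1) m(1) assms(2) pow_eq_id[OF assms(2)]
    by (metis cong_0_iff k_def mult_dvd_mono dvd_refl mult.commute)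
  moreover have "[a + b = 1] (mod m * p ^ k)"
    using cong_add[OF a(1) b(1)] cong_add[OF a(2) b(2)] cpk by (simp add: coprime_cong_mult_nat)
  then have "x [^] a \<otimes> x [^] b = x"
    using pow_cong[OF assms(2) o] assms(2) by (simp add: nat_pow_mult)
  ultimately show ?thesis using that[OF cp] assms(2) by (simp add: nat_pow_pow)
qed

text \<open>A suitable power of \<open>s \<otimes> u\<close> is \<open>s\<close>, and the exponent can be chosen to serve both
  decompositions.\<close>

lemma p_part_decomposition_unique:
  fixes m m' :: nat
  assumes "{s, u, s', u'} \<subseteq> carrier G" "prime p"
    and "s \<otimes> u = u \<otimes> s" "s' \<otimes> u' = u' \<otimes> s'" "s \<otimes> u = s' \<otimes> u'"
    and "coprime m p" "coprime m' p" "s [^] m = \<one>" "s' [^] m' = \<one>"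
    and "u [^] (p ^ k) = \<one>" "u' [^] (p ^ k') = \<one>"
  shows "s = s'" "u = u'"
proof -
  have c: "s \<in> carrier G" "u \<in> carrier G" "s' \<in> carrier G" "u' \<in> carrier G" using assms(1) by auto
  have "coprime (m * m') (p ^ (k + k'))" using assms(6,7) by simp
  then obtain a where a: "[a = 1] (mod m * m')" "[a = 0] (mod p ^ (k + k'))"
    using binary_chinese_remainder_nat by metis
  have "[a = 1] (mod m)" "[a = 1] (mod m')" "[a = 0] (mod p ^ k)" "[a = 0] (mod p ^ k')"
    using a cong_modulus_mult_nat[of a 1 m m'] cong_modulus_mult_nat[of a 1 m' m]
      cong_modulus_mult_nat[of a 0 "p^k" "p^k'"] cong_modulus_mult_nat[of a 0 "p^k'" "p^k"]
    by (simp_all add: mult.commute power_add)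
  then have "s [^] a = s" "s' [^] a = s'" "u [^] a = \<one>" "u' [^] a = \<one>"
    using pow_cong[of s m a 1] pow_cong[of s' m' a 1] pow_cong[of u "p^k" a 0]
      pow_cong[of u' "p^k'" a 0] assms c by auto
  then show "s = s'"
    using pow_mult_distrib[OF assms(3) c(1,2), of a] pow_mult_distrib[OF assms(4) c(3,4), of a] assms(5) c
    by simp
  then show "u = u'" using assms(5) c by simp
qed

end

section \<open>Matrices over finite fields\<close>

lemma prime_CHAR_finite: "prime CHAR('a::{field,finite})"
  by (rule prime_CHAR_semidom, rule finite_imp_CHAR_pos) simp

text \<open>Cauchy's theorem for the additive group, taken from Sylow's theorem with exponent 1: a
  prime dividing the cardinality kills some nonzero element, hence is the characteristic. In the
  hermitian case only the cardinality \<open>q\<^sup>2\<close> is given, and this is how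
  \<open>q\<close> is recognized as a power of the characteristic.\<close>

lemma card_eq_CHAR_power: "\<exists>k. CARD('a::{field,finite}) = CHAR('a) ^ k"
proof -
  \<comment> \<open>The additive group is presented multiplicatively so that Sylow's theorem
    applies; its powers are then integer multiples.\<close>
  define G where "G = \<lparr>carrier = (UNIV :: 'a set), monoid.mult = (+), one = (0 :: 'a)\<rparr>"
  interpret G: group G
    by (rule groupI) (auto simp: G_def ac_simps intro: exI[of _ "- x" for x])
  have pw: "x [^]\<^bsub>G\<^esub> (n::nat) = of_nat n * x" for x n
    by (induction n) (auto simp: G_def nat_pow_def algebra_simps)
  have only_p: "r = CHAR('a)" if r: "prime r" "r dvd CARD('a)" for r
  proof -
    obtain m where m: "CARD('a) = r ^ 1 * m" using r(2) by (auto elim: dvdE)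
    obtain H where H: "subgroup H G" "card H = r ^ 1"
      using sylow_thm[OF r(1) G.group_axioms, of 1 m] m unfolding Coset.order_def by (auto simp: G_def)
    have "H \<noteq> {0}" using H(2) r(1) by auto
    moreover have "0 \<in> H" using subgroup.one_closed[OF H(1)] by (simp add: G_def)
    ultimately obtain x where x: "x \<in> H" "x \<noteq> 0" by blast
    have "x [^]\<^bsub>G\<^esub> r = \<one>\<^bsub>G\<^esub>"
    proof -
      interpret S: group "G\<lparr>carrier := H\<rparr>" using H(1) G.subgroup_imp_group by blast
      have "x [^]\<^bsub>G\<lparr>carrier := H\<rparr>\<^esub> Coset.order (G\<lparr>carrier := H\<rparr>) = \<one>\<^bsub>G\<^esub>"
        using S.pow_order_eq_1[of x] x by simp
      then show ?thesis using H(2) by (simp add: Coset.order_def nat_pow_def)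
    qed
    then have "of_nat r = (0::'a)" using x pw[of x r] by (simp add: G_def)
    then have "CHAR('a) dvd r" by (simp add: of_nat_eq_0_iff_char_dvd)
    then show ?thesis
      using r(1) prime_CHAR_finite[where 'a = 'a] primes_dvd_imp_eq by blast
  qed
  have "\<not> is_unit CHAR('a)" using prime_CHAR_finite[where 'a = 'a] not_prime_unit by blast
  then obtain k m where m: "CARD('a) = CHAR('a) ^ k * m" "\<not> CHAR('a) dvd m"
    using multiplicity_decompose'[of "CARD('a)" "CHAR('a)"] zero_less_card_finite by blast
  \<comment> \<open>A prime factor of the cofactor \<open>m\<close> would also be the
    characteristic, but all factors equal to it have been split off.\<close>
  have "m = 1"
  proof (rule ccontr)
    assume "m \<noteq> 1"
    then obtain r where r: "prime r" "r dvd m" using prime_factor_nat by blast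
    have "r dvd CARD('a)" using r(2) unfolding m(1) by (rule dvd_mult)
    then show False using only_p[OF r(1)] r(2) m(2) by simp
  qed
  then show ?thesis using m(1) by (metis mult_1_right)
qed

section \<open>The general linear group and its semisimple and unipotent elements\<close>

lemma group_GL: "group (GL n :: 'a::field mat monoid)"
proof -
  interpret ring "ring_mat TYPE('a) n ()" by (rule ring_mat)
  show ?thesis unfolding GL_def by (rule units_group)
qed

lemma GL_mult [simp]: "A \<otimes>\<^bsub>GL n\<^esub> B = A * B"
  and GL_one [simp]: "\<one>\<^bsub>GL n\<^esub> = 1\<^sub>m n"
  by (simp_all add: GL_def units_of_def ring_mat_simps)

lemma carrier_GL_iff: "A \<in> carrier (GL n) \<longleftrightarrow> A \<in> carrier_mat n n \<and> det A \<noteq> 0"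
  using unit_imp_det_non_zero[of A n "()"] det_non_zero_imp_unit[of A n "()"]
  by (auto simp: GL_def units_of_def Units_def ring_mat_simps)

lemma GL_carrier_mat: "A \<in> carrier (GL n) \<Longrightarrow> A \<in> carrier_mat n n"
  by (simp add: carrier_GL_iff)

lemma mat_inv_eq: "A \<in> carrier (GL n) \<Longrightarrow> mat_inv A = inv\<^bsub>GL n\<^esub> A"
  using GL_carrier_mat by (fastforce simp: mat_inv_def)

lemma mat_inv_GL:
  assumes "A \<in> carrier (GL n)"
  shows "mat_inv A \<in> carrier (GL n)" "mat_inv A * A = 1\<^sub>m n" "A * mat_inv A = 1\<^sub>m n"
  using assms group.inv_closed[OF group_GL] group.l_inv[OF group_GL, of A n]
    group.r_inv[OF group_GL, of A n] by (simp_all add: mat_inv_eq)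

lemma finite_GL: "finite (carrier (GL n :: 'a::{field,finite} mat monoid))"
proof (rule finite_subset)
  show "carrier (GL n :: 'a mat monoid) \<subseteq>
      (\<lambda>f. mat n n f) ` ({..<n} \<times> {..<n} \<rightarrow>\<^sub>E UNIV)"
  proof
    fix A :: "'a mat" assume "A \<in> carrier (GL n)"
    then have "A = mat n n (restrict (\<lambda>ij. A $$ ij) ({..<n} \<times> {..<n}))"
      using GL_carrier_mat[of A n] by (intro eq_matI) auto
    then show "A \<in> (\<lambda>f. mat n n f) ` ({..<n} \<times> {..<n} \<rightarrow>\<^sub>E UNIV)" by auto
  qed
qed (auto intro!: finite_PiE)

lemma conj_class_eq_iff:
  assumes "subgroup H (GL n)" "X \<in> carrier (GL n)" "Y \<in> carrier (GL n)"
  shows "conj_class H X = conj_class H Y \<longleftrightarrow> (\<exists>Z\<in>H. Z * Y = X * Z)"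
proof -
  have "mat_inv Z = inv\<^bsub>GL n\<^esub> Z" if "Z \<in> H" for Z
    using that assms(1) mat_inv_eq subgroup.mem_carrier by metis
  then have "conj_class H W = {inv\<^bsub>GL n\<^esub> Z \<otimes>\<^bsub>GL n\<^esub> W \<otimes>\<^bsub>GL n\<^esub> Z | Z. Z \<in> H}" for W
    unfolding conj_class_def by (auto; metis)
  then show ?thesis using group.conj_set_eq_iff[OF group_GL assms] by simp
qed

text \<open>Divisors of a number prime to the characteristic are prime to it, so any annihilating
  exponent of this kind will do and the exact order need not be known. An exponent, unlike the
  order, is carried along directly by an intertwining equation.\<close>

lemma semisimple_iff:
  fixes A :: "'a::{field,finite} mat"
  assumes "A \<in> carrier (GL n)"
  shows "semisimple A \<longleftrightarrow> (\<exists>m. coprime m CHAR('a) \<and> A [^]\<^bsub>GL n\<^esub> (m::nat) = 1\<^sub>m n)"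
proof -
  have "mat_order A = group.ord (GL n) A" using assms GL_carrier_mat by (fastforce simp: mat_order_def)
  then have *: "A [^]\<^bsub>GL n\<^esub> m = 1\<^sub>m n \<longleftrightarrow> mat_order A dvd m" for m :: nat
    using group.pow_eq_id[OF group_GL assms, of m] by simp
  then show ?thesis unfolding semisimple_def * by (meson coprime_divisors dvd_refl)
qed

text \<open>The same device for unipotent elements: every divisor of a prime power is again a power
  of that prime.\<close>

lemma unipotent_iff:
  fixes A :: "'a::{field,finite} mat"
  assumes "A \<in> carrier (GL n)"
  shows "unipotent A \<longleftrightarrow> (\<exists>k. A [^]\<^bsub>GL n\<^esub> (CHAR('a) ^ k) = 1\<^sub>m n)"
proof -
  have "mat_order A = group.ord (GL n) A" using assms GL_carrier_mat by (fastforce simp: mat_order_def)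
  then have *: "A [^]\<^bsub>GL n\<^esub> m = 1\<^sub>m n \<longleftrightarrow> mat_order A dvd m" for m :: nat
    using group.pow_eq_id[OF group_GL assms, of m] by simp
  then show ?thesis unfolding unipotent_def *
    using divides_primepow_nat[OF prime_CHAR_finite[where 'a = 'a]] by auto
qed

lemma semisimple_conj:
  fixes X :: "'a::{field,finite} mat"
  assumes "X \<in> carrier (GL n)" "Y \<in> carrier (GL n)" "Z \<in> carrier (GL n)" "Z * Y = X * Z" "semisimple X"
  shows "semisimple Y"
  using assms group.intertwine_pow_one[OF group_GL assms(1-3)] by (auto simp: semisimple_iff)

lemma unipotent_conj:
  fixes X :: "'a::{field,finite} mat"
  assumes "X \<in> carrier (GL n)" "Y \<in> carrier (GL n)" "Z \<in> carrier (GL n)" "Z * Y = X * Z" "unipotent X"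
  shows "unipotent Y"
  using assms group.intertwine_pow_one[OF group_GL assms(1-3)] by (auto simp: unipotent_iff)

section \<open>Commuting semisimple and unipotent parts of a matrix\<close>

lemma subgroup_pow_closed:
  assumes "group G" "subgroup H G" "x \<in> H"
  shows "x [^]\<^bsub>G\<^esub> (k::nat) \<in> H"
  using assms by (induction k) (auto simp: subgroup.one_closed subgroup.m_closed)

text \<open>The order of \<open>X\<close> is taken in \<open>GL n\<close>, but powers of
  \<open>X\<close> never leave \<open>H\<close>; hence the two parts of an isometry are
  isometries.\<close>

lemma jordan_decomposition_exists:
  fixes X :: "'a::{field,finite} mat"
  assumes "subgroup H (GL n)" "X \<in> H"
  obtains S U where "S \<in> H" "U \<in> H" "semisimple S" "unipotent U" "S * U = X" "S * U = U * S"
proof -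
  have X: "X \<in> carrier (GL n)" using assms subgroup.mem_carrier by metis
  obtain a b m k :: nat where *: "coprime m CHAR('a)" "(X [^]\<^bsub>GL n\<^esub> a) [^]\<^bsub>GL n\<^esub> m = 1\<^sub>m n"
      "(X [^]\<^bsub>GL n\<^esub> b) [^]\<^bsub>GL n\<^esub> (CHAR('a) ^ k) = 1\<^sub>m n"
      "X [^]\<^bsub>GL n\<^esub> a * X [^]\<^bsub>GL n\<^esub> b = X"
    using group.ex_p_part_decomposition[OF group_GL finite_GL X prime_CHAR_finite[where 'a = 'a]] by (metis GL_mult GL_one)
  have H: "X [^]\<^bsub>GL n\<^esub> (a::nat) \<in> H" for a using subgroup_pow_closed[OF group_GL assms] .
  then have G: "X [^]\<^bsub>GL n\<^esub> (a::nat) \<in> carrier (GL n)" for a using assms(1) subgroup.mem_carrier by metis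
  have "semisimple (X [^]\<^bsub>GL n\<^esub> a)" "unipotent (X [^]\<^bsub>GL n\<^esub> b)"
    using *(1-3) semisimple_iff[OF G] unipotent_iff[OF G] by blast+
  moreover have "X [^]\<^bsub>GL n\<^esub> a * X [^]\<^bsub>GL n\<^esub> b = X [^]\<^bsub>GL n\<^esub> b * X [^]\<^bsub>GL n\<^esub> a"
    using monoid.nat_pow_comm[OF group.is_monoid[OF group_GL] X, of a b] by simp
  ultimately show ?thesis using that H *(4) by blast
qed

lemma jordan_decomposition_unique:
  fixes S :: "'a::{field,finite} mat"
  assumes "{S, U, S', U'} \<subseteq> carrier (GL n)" "S * U = U * S" "S' * U' = U' * S'" "S * U = S' * U'"
    and "semisimple S" "semisimple S'" "unipotent U" "unipotent U'"
  shows "S = S'" "U = U'"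
proof -
  obtain m m' k k' where "coprime m CHAR('a)" "coprime m' CHAR('a)" "S [^]\<^bsub>GL n\<^esub> (m::nat) = 1\<^sub>m n"
    "S' [^]\<^bsub>GL n\<^esub> (m'::nat) = 1\<^sub>m n" "U [^]\<^bsub>GL n\<^esub> (CHAR('a) ^ k) = 1\<^sub>m n"
    "U' [^]\<^bsub>GL n\<^esub> (CHAR('a) ^ k') = 1\<^sub>m n"
    using assms(1,5-8) by (auto simp: semisimple_iff unipotent_iff)
  then show "S = S'" "U = U'"
    using group.p_part_decomposition_unique[OF group_GL assms(1) prime_CHAR_finite[where 'a = 'a],
        of m m' k k'] assms by simp_all
qed

section \<open>Isometries between forms\<close>

text \<open>In the hermitian case \<open>q\<close> divides \<open>q\<^sup>2\<close>, which is a
  power of the characteristic, so \<open>q\<close> is one too and \<open>bar\<close> is an iterate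
  of the Frobenius map.\<close>

lemma bar_sum:
  fixes f :: "'b \<Rightarrow> 'a::{field,finite}"
  assumes "CARD('a) = (if \<kappa> = Hermitian then q\<^sup>2 else q)"
  shows "bar \<kappa> q (sum f I) = (\<Sum>i\<in>I. bar \<kappa> q (f i))"
proof (cases "\<kappa> = Hermitian")
  case True
  obtain k where "q\<^sup>2 = CHAR('a) ^ k" using card_eq_CHAR_power[where 'a = 'a] assms True by auto
  then have "q dvd CHAR('a) ^ k" by (metis dvd_triv_left power2_eq_square)
  then obtain j where "q = CHAR('a) ^ j"
    using divides_primepow_nat[OF prime_CHAR_finite[where 'a = 'a]] by blast
  then show ?thesis
    using freshmans_dream_sum'[OF prime_CHAR_finite[where 'a = 'a], of q j f I] True
    by (simp add: bar_def)
qed (simp add: bar_def)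

lemma bar_mult: "bar \<kappa> q (x * y) = bar \<kappa> q x * bar \<kappa> q y"
  by (simp add: bar_def power_mult_distrib)

lemma star_carrier [simp]: "A \<in> carrier_mat m n \<Longrightarrow> star \<kappa> q A \<in> carrier_mat n m"
  by (auto simp: star_def)

lemma star_mult:
  fixes A B :: "'a::{field,finite} mat"
  assumes "CARD('a) = (if \<kappa> = Hermitian then q\<^sup>2 else q)"
    and "A \<in> carrier_mat l m" "B \<in> carrier_mat m n"
  shows "star \<kappa> q (A * B) = star \<kappa> q B * star \<kappa> q A"
  using assms(2,3)
  by (intro eq_matI) (auto simp: star_def scalar_prod_def bar_sum[OF assms(1)] bar_mult mult.commute)

text \<open>A quadratic form is treated as a function of two arguments that ignores the second one.\<close>

definition form_val :: "form_type \<Rightarrow> nat \<Rightarrow> 'a::field mat \<Rightarrow> 'a mat \<Rightarrow> 'a mat \<Rightarrow> 'a" where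
  "form_val \<kappa> q B u v = (if \<kappa> = Quadratic then sesq \<kappa> q B u u else sesq \<kappa> q B u v)"

lemma quad_eq_sesq: "quad B u = sesq Quadratic q B u u"
proof -
  have "star Quadratic q u = transpose_mat u" by (rule eq_matI) (auto simp: star_def bar_def)
  then show ?thesis by (simp add: quad_def sesq_def)
qed

text \<open>The order of the arguments follows \<open>congruent_via\<close>: multiplication by
  \<open>P\<close> takes the space with form \<open>C\<close> to the space with form
  \<open>B\<close>, as a solution of \<open>P * B * star \<kappa> q P = C\<close> does.\<close>

definition isometries :: "form_type \<Rightarrow> nat \<Rightarrow> 'a::field mat \<Rightarrow> 'a mat \<Rightarrow> 'a mat set" where
  "isometries \<kappa> q B C = {P \<in> carrier (GL (dim_row B)).
     \<forall>u\<in>rows_space (dim_row B). \<forall>v\<in>rows_space (dim_row B).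
       form_val \<kappa> q B (u * P) (v * P) = form_val \<kappa> q C u v}"

lemma isom_group_eq: "isom_group \<kappa> q B = isometries \<kappa> q B B"
  by (auto simp: isom_group_def isometries_def form_val_def Let_def quad_eq_sesq[of _ _ q])

text \<open>The terms with indices (i, j) and (j, i) cancel and the diagonal terms vanish.
  Transposing the whole sum would show only that twice its value is 0, which says nothing in
  characteristic 2; hence the pairwise cancellation.\<close>

lemma quad_alternating:
  assumes "A \<in> carrier_mat n n" "alternating_mat A" "v \<in> rows_space n"
  shows "quad A v = (0::'a::field)"
proof -
  have anti: "A $$ (i, j) = - A $$ (j, i)" if "i < n" "j < n" for i j
  proof -
    have "transpose_mat A $$ (j, i) = (- A) $$ (j, i)" using assms(2) by (simp add: alternating_mat_def)
    then show ?thesis using assms(1) that by auto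
  qed
  define f where "f i j = v $$ (0, i) * A $$ (i, j) * v $$ (0, j)" for i j
  have fa: "f i j = - f j i" if "i < n" "j < n" for i j
    using anti[OF that] by (simp add: f_def)
  have fd: "f i i = 0" if "i < n" for i
    using assms(1,2) that by (simp add: f_def alternating_mat_def)
  \<comment> \<open>Enlarging the square by one index adds a row and a column that cancel each
    other, and a diagonal entry that is 0.\<close>
  have partial: "(\<Sum>i<m. \<Sum>j<m. f i j) = 0" if "m \<le> n" for m
    using that
  proof (induction m)
    case (Suc m)
    have "(\<Sum>i<m. f i m) = - (\<Sum>i<m. f m i)"
      unfolding sum_negf[symmetric] using Suc.prems by (intro sum.cong fa) auto
    then show ?case using Suc fd[of m] by (simp add: sum.distrib)
  qed simp
  have "quad A v = (\<Sum>i<n. \<Sum>j<n. f i j)"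
    using assms(1,3)
    by (simp add: quad_def scalar_prod_def atLeast0LessThan f_def sum_distrib_left mult.assoc)
  also have "\<dots> = 0" using partial[of n] by simp
  finally show ?thesis .
qed

lemma quad_minus:
  assumes "A \<in> carrier_mat n n" "B \<in> carrier_mat n n" "v \<in> rows_space n"
  shows "quad (A - B) v = quad A v - quad B (v :: 'a::field mat)"
proof -
  have "v * (A - B) * transpose_mat v = v * A * transpose_mat v - v * B * transpose_mat v"
    using assms mult_minus_distrib_mat[of v 1 n A n B]
      minus_mult_distrib_mat[of "v * A" 1 n "v * B" "transpose_mat v" 1] by auto
  then show ?thesis using assms by (auto simp: quad_def)
qed

text \<open>Moving \<open>P\<close> from the vectors into the matrix gives the values of the form
  with matrix \<open>P * B * star \<kappa> q P\<close>. In the quadratic case this matrix may differ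
  from \<open>C\<close>, but only by an alternating matrix, whose quadratic form is 0.\<close>

lemma congruent_via_isometry:
  fixes B C :: "'a::{field,finite} mat"
  assumes card: "CARD('a) = (if \<kappa> = Hermitian then q\<^sup>2 else q)"
    and B: "B \<in> carrier_mat n n" and cong: "congruent_via \<kappa> q P B C"
  shows "P \<in> isometries \<kappa> q B C"
proof -
  have dr: "dim_row B = n" using B by simp
  have PG: "P \<in> carrier (GL n)" and C: "C \<in> carrier_mat n n" using cong dr by (auto simp: congruent_via_def)
  then have P: "P \<in> carrier_mat n n" using GL_carrier_mat by blast
  have sesq: "sesq \<kappa> q B (u * P) (v * P) = sesq \<kappa> q (P * B * star \<kappa> q P) u v"
    if "u \<in> rows_space n" "v \<in> rows_space n" for u v
  proof -
    have [simp]: "star \<kappa> q P \<in> carrier_mat n n" "star \<kappa> q v \<in> carrier_mat n 1" using P that by auto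
    have "u * P * B * star \<kappa> q (v * P) = u * P * B * (star \<kappa> q P * star \<kappa> q v)"
      using star_mult[OF card that(2) P] by simp
    also have "\<dots> = u * (P * B * star \<kappa> q P) * star \<kappa> q v"
    proof -
      have "P * B \<in> carrier_mat n n" "star \<kappa> q P * star \<kappa> q v \<in> carrier_mat n 1"
        "B * (star \<kappa> q P * star \<kappa> q v) \<in> carrier_mat n 1"
        using P B that(2) by (auto intro!: mult_carrier_mat[of _ n n])
      then show ?thesis using P B that
        by (simp add: assoc_mult_mat[of _ 1 n _ n _ 1] assoc_mult_mat[of _ 1 n _ n _ n]
            assoc_mult_mat[of _ n n _ n _ 1] assoc_mult_mat[of _ n n _ n _ n])
    qed
    finally show ?thesis by (simp add: sesq_def)
  qed
  have "form_val \<kappa> q B (u * P) (v * P) = form_val \<kappa> q C u v"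
    if u: "u \<in> rows_space n" and v: "v \<in> rows_space n" for u v
  proof (cases "\<kappa> = Quadratic")
    case True
    have "star \<kappa> q P = transpose_mat P" using True by (intro eq_matI) (auto simp: star_def bar_def)
    then have alt: "alternating_mat (P * B * star \<kappa> q P - C)" using cong True by (simp add: congruent_via_def)
    have PBP: "P * B * star \<kappa> q P \<in> carrier_mat n n" using P B by (meson mult_carrier_mat star_carrier)
    have "quad (P * B * star \<kappa> q P - C) u = 0"
      using quad_alternating[OF _ alt u] C by (simp add: minus_carrier_mat)
    then have "quad (P * B * star \<kappa> q P) u = quad C u" using quad_minus[OF PBP C u] by simp
    then show ?thesis using sesq[OF u u] True by (simp add: form_val_def quad_eq_sesq[of _ _ q])
  next
    case False
    then have "P * B * star \<kappa> q P = C" using cong by (simp add: congruent_via_def)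
    then show ?thesis using False sesq[OF u v] by (simp add: form_val_def)
  qed
  then show ?thesis using PG dr by (simp add: isometries_def)
qed

text \<open>Row vectors are acted on from the right, so the map applied first, \<open>Q\<close>, is
  the left factor.\<close>

lemma isometries_mult:
  assumes "P \<in> isometries \<kappa> q B C" "Q \<in> isometries \<kappa> q C D" "dim_row C = dim_row B"
  shows "Q * P \<in> isometries \<kappa> q B D"
proof -
  let ?n = "dim_row B"
  have PQ: "P \<in> carrier (GL ?n)" "Q \<in> carrier (GL ?n)" using assms by (auto simp: isometries_def)
  then have c: "P \<in> carrier_mat ?n ?n" "Q \<in> carrier_mat ?n ?n" using GL_carrier_mat by blast+
  have "Q * P \<in> carrier (GL ?n)"
    using PQ monoid.m_closed[OF group.is_monoid[OF group_GL], of Q ?n P] by simp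
  moreover have "form_val \<kappa> q B (u * (Q * P)) (v * (Q * P)) = form_val \<kappa> q D u v"
    if "u \<in> rows_space ?n" "v \<in> rows_space ?n" for u v
  proof -
    have "u * (Q * P) = u * Q * P" "v * (Q * P) = v * Q * P"
      using that c by (simp_all add: assoc_mult_mat)
    moreover have "u * Q \<in> rows_space ?n" "v * Q \<in> rows_space ?n" using that c by auto
    ultimately show ?thesis using assms that by (simp add: isometries_def)
  qed
  ultimately show ?thesis by (simp add: isometries_def)
qed

lemma isometries_inv:
  assumes "P \<in> isometries \<kappa> q B C" "dim_row C = dim_row B"
  shows "mat_inv P \<in> isometries \<kappa> q C B"
proof -
  let ?n = "dim_row B"
  have P: "P \<in> carrier (GL ?n)" using assms by (auto simp: isometries_def)
  note i = mat_inv_GL[OF P]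
  have c: "P \<in> carrier_mat ?n ?n" "mat_inv P \<in> carrier_mat ?n ?n" using P i GL_carrier_mat by blast+
  have "form_val \<kappa> q C (u * mat_inv P) (v * mat_inv P) = form_val \<kappa> q B u v"
    if "u \<in> rows_space ?n" "v \<in> rows_space ?n" for u v
  proof -
    have "u * mat_inv P * P = u" "v * mat_inv P * P = v"
      using that c i by (simp_all add: assoc_mult_mat[of _ 1 ?n _ ?n _ ?n])
    moreover have "u * mat_inv P \<in> rows_space ?n" "v * mat_inv P \<in> rows_space ?n" using that c by auto
    moreover from this have "form_val \<kappa> q B (u * mat_inv P * P) (v * mat_inv P * P) =
        form_val \<kappa> q C (u * mat_inv P) (v * mat_inv P)"
      using assms(1) unfolding isometries_def by blast
    ultimately show ?thesis by simp
  qed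
  then show ?thesis using i assms(2) by (simp add: isometries_def)
qed

lemma isometries_GL: "P \<in> isometries \<kappa> q B C \<Longrightarrow> P \<in> carrier (GL (dim_row B))"
  by (simp add: isometries_def)

lemma subgroup_isom_group: "subgroup (isom_group \<kappa> q B) (GL (dim_row B))"
proof -
  interpret group "GL (dim_row B)" by (rule group_GL)
  have "1\<^sub>m (dim_row B) \<in> isom_group \<kappa> q B"
    using one_closed by (auto simp: isom_group_eq isometries_def)
  moreover have "inv\<^bsub>GL (dim_row B)\<^esub> X \<in> isom_group \<kappa> q B" if "X \<in> isom_group \<kappa> q B" for X
    using isometries_inv[of X \<kappa> q B B] that isometries_GL[of X \<kappa> q B B] by (simp add: isom_group_eq mat_inv_eq)
  ultimately show ?thesis
    by (intro subgroupI) (auto simp: isom_group_eq isometries_mult dest: isometries_GL)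
qed

lemma subgroup_centralizer:
  assumes "subgroup H (GL n)" "S \<in> carrier_mat n n"
  shows "subgroup (centralizer H S) (GL n)"
proof -
  interpret group "GL n" by (rule group_GL)
  interpret H: subgroup H "GL n" by fact
  have c: "X \<in> carrier_mat n n" if "X \<in> H" for X using that GL_carrier_mat H.mem_carrier by blast
  show ?thesis
  proof (rule subgroupI)
    show "centralizer H S \<subseteq> carrier (GL n)" using H.mem_carrier by (auto simp: centralizer_def)
    have "1\<^sub>m n \<in> centralizer H S" using H.one_closed assms(2) by (simp add: centralizer_def)
    then show "centralizer H S \<noteq> {}" by blast
  next
    fix X assume X: "X \<in> centralizer H S"
    then have XG: "X \<in> carrier (GL n)" and XS: "X * S = S * X" and XH: "X \<in> H"
      using H.mem_carrier by (auto simp: centralizer_def)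
    note i = mat_inv_GL[OF XG]
    have ic: "mat_inv X \<in> carrier_mat n n" using i GL_carrier_mat by blast
    have "mat_inv X * S = mat_inv X * (S * X) * mat_inv X"
      using i ic c[OF XH] assms(2) by (simp add: assoc_mult_mat[of _ n n _ n _ n])
    also have "\<dots> = (mat_inv X * X) * S * mat_inv X"
      unfolding XS[symmetric] using ic c[OF XH] assms(2) by (simp add: assoc_mult_mat[of _ n n _ n _ n])
    finally show "inv\<^bsub>GL n\<^esub> X \<in> centralizer H S"
      using i assms(2) XH H.m_inv_closed[OF XH] by (simp add: centralizer_def mat_inv_eq[OF XG])
  next
    fix X Y assume XY: "X \<in> centralizer H S" "Y \<in> centralizer H S"
    then have "X \<in> H" "Y \<in> H" and e: "X * S = S * X" "Y * S = S * Y" by (auto simp: centralizer_def)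
    note cc = c[OF this(1)] c[OF this(2)]
    have "X * Y * S = X * (Y * S)" using cc assms(2) by (simp add: assoc_mult_mat[of _ n n _ n _ n])
    also have "\<dots> = X * S * Y" unfolding e(2) using cc assms(2) by (simp add: assoc_mult_mat[of _ n n _ n _ n])
    also have "\<dots> = S * (X * Y)" unfolding e(1) using cc assms(2) by (simp add: assoc_mult_mat[of _ n n _ n _ n])
    finally show "X \<otimes>\<^bsub>GL n\<^esub> Y \<in> centralizer H S"
      using XY H.m_closed[of X Y] by (simp add: centralizer_def)
  qed
qed

section \<open>Block diagonal matrices\<close>

text \<open>This is one unfolding of \<open>diag_block_mat\<close>, with the zero blocks sized in
  the same way, so that facts about lists of blocks follow by induction from facts about two
  blocks.\<close>

abbreviation diag2 :: "'a::zero mat \<Rightarrow> 'a mat \<Rightarrow> 'a mat" where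
  "diag2 A D \<equiv> four_block_mat A (0\<^sub>m (dim_row A) (dim_col D)) (0\<^sub>m (dim_row D) (dim_col A)) D"

lemma diag_block_mat_Cons: "diag_block_mat (A # As) = diag2 A (diag_block_mat As)"
  by (simp add: Let_def)

lemma diag2_mult:
  fixes A B :: "'a::field mat"
  assumes "A \<in> carrier_mat n n" "B \<in> carrier_mat n n" "C \<in> carrier_mat m m" "D \<in> carrier_mat m m"
  shows "diag2 A C * diag2 B D = diag2 (A * B) (C * D)"
  using assms by (simp add: mult_four_block_mat[of _ n n _ m _ m _ _ n _ m])

lemma diag2_inject:
  assumes "A \<in> carrier_mat n n" "B \<in> carrier_mat n n" "C \<in> carrier_mat m m" "D \<in> carrier_mat m m"
    and "diag2 A C = diag2 B D"
  shows "A = B" "C = D"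
proof -
  have e: "diag2 A C $$ (i, j) = diag2 B D $$ (i, j)" for i j using assms by simp
  have "A $$ (i, j) = B $$ (i, j)" if "i < n" "j < n" for i j
    using e[of i j] assms(1-4) that by simp
  then show "A = B" using assms(1,2) by (intro eq_matI) auto
  have "C $$ (i, j) = D $$ (i, j)" if "i < m" "j < m" for i j
    using e[of "n + i" "n + j"] assms(1-4) that by simp
  then show "C = D" using assms(3,4) by (intro eq_matI) auto
qed

lemma diag2_GL_iff:
  fixes A :: "'a::field mat"
  assumes "A \<in> carrier_mat n n" "D \<in> carrier_mat m m"
  shows "diag2 A D \<in> carrier (GL (n + m)) \<longleftrightarrow> A \<in> carrier (GL n) \<and> D \<in> carrier (GL m)"
proof -
  have "det (diag2 A D) = det A * det D"
    using assms by (intro det_four_block_mat_upper_right_zero[of _ n _ m]) auto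
  then show ?thesis using assms by (auto simp: carrier_GL_iff)
qed

lemma diag2_pow:
  fixes A :: "'a::field mat"
  assumes "A \<in> carrier (GL n)" "D \<in> carrier (GL m)"
  shows "diag2 A D [^]\<^bsub>GL (n + m)\<^esub> (k::nat) = diag2 (A [^]\<^bsub>GL n\<^esub> k) (D [^]\<^bsub>GL m\<^esub> k)"
proof (induction k)
  case (Suc k)
  have "A [^]\<^bsub>GL n\<^esub> k \<in> carrier_mat n n" "D [^]\<^bsub>GL m\<^esub> k \<in> carrier_mat m m"
    using assms monoid.nat_pow_closed[OF group.is_monoid[OF group_GL]] GL_carrier_mat by blast+
  moreover have "A \<in> carrier_mat n n" "D \<in> carrier_mat m m" using assms GL_carrier_mat by blast+
  ultimately show ?case using Suc diag2_mult[of "A [^]\<^bsub>GL n\<^esub> k" n A "D [^]\<^bsub>GL m\<^esub> k" m D] by simp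
qed simp

text \<open>Powers are taken in each block. If the blocks are killed by the i-th and j-th powers of
  the characteristic \<open>p\<close>, then the exponent \<open>p ^ (i + j)\<close> kills
  both.\<close>

lemma diag2_unipotent_iff:
  fixes A :: "'a::{field,finite} mat"
  assumes "A \<in> carrier (GL n)" "D \<in> carrier (GL m)"
  shows "unipotent (diag2 A D) \<longleftrightarrow> unipotent A \<and> unipotent D"
proof -
  let ?p = "CHAR('a)"
  have c: "A [^]\<^bsub>GL n\<^esub> k \<in> carrier_mat n n" "D [^]\<^bsub>GL m\<^esub> k \<in> carrier_mat m m" for k :: nat
    using assms monoid.nat_pow_closed[OF group.is_monoid[OF group_GL]] GL_carrier_mat by blast+
  have AD: "diag2 A D \<in> carrier (GL (n + m))" using assms diag2_GL_iff GL_carrier_mat by blast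
  have one: "diag2 A D [^]\<^bsub>GL (n + m)\<^esub> k = 1\<^sub>m (n + m) \<longleftrightarrow>
      A [^]\<^bsub>GL n\<^esub> k = 1\<^sub>m n \<and> D [^]\<^bsub>GL m\<^esub> k = 1\<^sub>m m" for k :: nat
  proof
    assume "diag2 A D [^]\<^bsub>GL (n + m)\<^esub> k = 1\<^sub>m (n + m)"
    then have "diag2 (A [^]\<^bsub>GL n\<^esub> k) (D [^]\<^bsub>GL m\<^esub> k) = diag2 (1\<^sub>m n) (1\<^sub>m m)"
      using diag2_pow[OF assms, of k] by simp
    from diag2_inject[OF c(1) one_carrier_mat c(2) one_carrier_mat this]
    show "A [^]\<^bsub>GL n\<^esub> k = 1\<^sub>m n \<and> D [^]\<^bsub>GL m\<^esub> k = 1\<^sub>m m" by blast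
  qed (simp add: diag2_pow[OF assms])
  have step: "X [^]\<^bsub>GL l\<^esub> (?p ^ (i + j)) = 1\<^sub>m l" if "X \<in> carrier (GL l)" "X [^]\<^bsub>GL l\<^esub> (?p ^ i) = 1\<^sub>m l"
    for X :: "'a mat" and l i j
    using that group.pow_eq_id[OF group_GL that(1)] by (simp add: power_add)
  show ?thesis
    unfolding unipotent_iff[OF assms(1)] unipotent_iff[OF assms(2)] unipotent_iff[OF AD] one
    using step[OF assms(1)] step[OF assms(2)] by (metis add.commute)
qed

text \<open>Concatenation of rows is encoded as a four-block matrix with two lower blocks of height
  0, so that the product rule for four-block matrices covers the action of \<open>diag2\<close> on
  rows.\<close>

abbreviation row_append :: "'a::zero mat \<Rightarrow> 'a mat \<Rightarrow> 'a mat" where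
  "row_append u v \<equiv> four_block_mat u v (0\<^sub>m 0 (dim_col u)) (0\<^sub>m 0 (dim_col v))"

lemma rows_space_append:
  fixes u :: "'a::zero mat"
  assumes "u \<in> rows_space (n + m)"
  obtains u1 u2 where "u1 \<in> rows_space n" "u2 \<in> rows_space m" "u = row_append u1 u2"
proof
  let ?u1 = "mat 1 n (\<lambda>(i, j). u $$ (i, j))" and ?u2 = "mat 1 m (\<lambda>(i, j). u $$ (i, n + j))"
  show "?u1 \<in> rows_space n" "?u2 \<in> rows_space m" by auto
  show "u = row_append ?u1 ?u2"
    using assms by (intro eq_matI) auto
qed

lemma row_append_mult_diag2:
  fixes u :: "'a::field mat"
  assumes "u \<in> rows_space n" "v \<in> rows_space m" "A \<in> carrier_mat n n" "D \<in> carrier_mat m m"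
  shows "row_append u v * diag2 A D = row_append (u * A) (v * D)"
proof -
  have "0\<^sub>m 0 n * A = 0\<^sub>m 0 n" "0\<^sub>m 0 m * D = 0\<^sub>m 0 m" using assms by auto
  then show ?thesis
    using assms by (simp add: mult_four_block_mat[of _ 1 n _ m _ 0 _ _ n _ m])
qed

text \<open>The two groups of coordinates are orthogonal: the zero blocks leave no mixed terms, and
  the sum over the columns splits at \<open>n\<close>.\<close>

lemma sesq_diag2:
  fixes u v :: "'a::field mat"
  assumes "u \<in> rows_space n" "u' \<in> rows_space m" "v \<in> rows_space n" "v' \<in> rows_space m"
    and "B \<in> carrier_mat n n" "C \<in> carrier_mat m m"
  shows "sesq \<kappa> q (diag2 B C) (row_append u u') (row_append v v') = sesq \<kappa> q B u v + sesq \<kappa> q C u' v'"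
proof -
  have split: "sum f {..<n + m} = sum f {..<n} + (\<Sum>k<m. f (n + k))" for f :: "nat \<Rightarrow> 'a"
    by (induction m) (simp_all add: add.assoc)
  let ?w = "row_append (u * B) (u' * C)" and ?s = "row_append v v'"
  have "sesq \<kappa> q (diag2 B C) (row_append u u') (row_append v v') = (?w * star \<kappa> q ?s) $$ (0, 0)"
    using row_append_mult_diag2[OF assms(1,2,5,6)] by (simp add: sesq_def)
  also have "\<dots> = (\<Sum>k<n + m. ?w $$ (0, k) * bar \<kappa> q (?s $$ (0, k)))"
    using assms by (simp add: scalar_prod_def star_def atLeast0LessThan)
  also have "\<dots> = (\<Sum>k<n. (u * B) $$ (0, k) * bar \<kappa> q (v $$ (0, k))) +
      (\<Sum>k<m. (u' * C) $$ (0, k) * bar \<kappa> q (v' $$ (0, k)))"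
    using assms by (simp add: split)
  also have "\<dots> = sesq \<kappa> q B u v + sesq \<kappa> q C u' v'"
    using assms by (simp add: sesq_def scalar_prod_def star_def atLeast0LessThan del: assoc_mult_mat)
  finally show ?thesis .
qed

lemma form_val_diag2:
  fixes u v :: "'a::field mat"
  assumes "u \<in> rows_space n" "u' \<in> rows_space m" "v \<in> rows_space n" "v' \<in> rows_space m"
    and "B \<in> carrier_mat n n" "C \<in> carrier_mat m m"
  shows "form_val \<kappa> q (diag2 B C) (row_append u u') (row_append v v') =
    form_val \<kappa> q B u v + form_val \<kappa> q C u' v'"
  using sesq_diag2[OF assms] sesq_diag2[OF assms(1,2,1,2,5,6)] by (simp add: form_val_def)

lemma isom_group_iff:
  assumes "B \<in> carrier_mat n n"
  shows "X \<in> isom_group \<kappa> q B \<longleftrightarrow> X \<in> carrier (GL n) \<and>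
    (\<forall>u\<in>rows_space n. \<forall>v\<in>rows_space n. form_val \<kappa> q B (u * X) (v * X) = form_val \<kappa> q B u v)"
  using carrier_matD(1)[OF assms] by (simp add: isom_group_eq isometries_def)

lemma diag2_isom_group_iff:
  fixes B :: "'a::field mat"
  assumes B: "B \<in> carrier_mat n n" and C: "C \<in> carrier_mat m m"
    and X: "X \<in> carrier_mat n n" and Y: "Y \<in> carrier_mat m m"
  shows "diag2 X Y \<in> isom_group \<kappa> q (diag2 B C) \<longleftrightarrow> X \<in> isom_group \<kappa> q B \<and> Y \<in> isom_group \<kappa> q C"
    (is "?L \<longleftrightarrow> ?R")
proof -
  have BC: "diag2 B C \<in> carrier_mat (n + m) (n + m)" using B C by (rule four_block_carrier_mat)
  have app: "row_append u u' \<in> rows_space (n + m)"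
    if "u \<in> rows_space n" "u' \<in> rows_space m" for u u' :: "'a mat"
    using carrier_matD[OF that(1)] carrier_matD[OF that(2)] by (intro carrier_matI) simp_all
  have val: "form_val \<kappa> q (diag2 B C) (row_append u u' * diag2 X Y) (row_append v v' * diag2 X Y) =
      form_val \<kappa> q B (u * X) (v * X) + form_val \<kappa> q C (u' * Y) (v' * Y)"
    if "u \<in> rows_space n" "u' \<in> rows_space m" "v \<in> rows_space n" "v' \<in> rows_space m" for u u' v v'
    unfolding row_append_mult_diag2[OF that(1,2) X Y] row_append_mult_diag2[OF that(3,4) X Y]
    using that X Y B C by (intro form_val_diag2) (rule mult_carrier_mat, assumption+)+
  show ?thesis
  proof
    assume L: ?L
    have inv: "form_val \<kappa> q B (u * X) (v * X) + form_val \<kappa> q C (u' * Y) (v' * Y) =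
        form_val \<kappa> q B u v + form_val \<kappa> q C u' v'"
      if "u \<in> rows_space n" "u' \<in> rows_space m" "v \<in> rows_space n" "v' \<in> rows_space m" for u u' v v'
      using L app[OF that(1,2)] app[OF that(3,4)] val[OF that] form_val_diag2[OF that B C, of \<kappa> q]
      unfolding isom_group_iff[OF BC] by metis
    \<comment> \<open>Filling the other coordinates with zeros isolates one block: the zero vector
      is mapped to itself, so its contribution is the same on both sides and cancels.\<close>
    have z: "0\<^sub>m 1 n \<in> rows_space n" "0\<^sub>m 1 m \<in> rows_space m" "0\<^sub>m 1 n * X = 0\<^sub>m 1 n" "0\<^sub>m 1 m * Y = 0\<^sub>m 1 m"
      using X Y by auto
    have "form_val \<kappa> q B (u * X) (v * X) = form_val \<kappa> q B u v"
      if "u \<in> rows_space n" "v \<in> rows_space n" for u v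
      using inv[OF that(1) z(2) that(2) z(2)] unfolding z by simp
    moreover have "form_val \<kappa> q C (u * Y) (v * Y) = form_val \<kappa> q C u v"
      if "u \<in> rows_space m" "v \<in> rows_space m" for u v
      using inv[OF z(1) that(1) z(1) that(2)] unfolding z by simp
    moreover have "X \<in> carrier (GL n)" "Y \<in> carrier (GL m)"
      using L diag2_GL_iff[OF X Y] unfolding isom_group_iff[OF BC] by blast+
    ultimately show ?R unfolding isom_group_iff[OF B] isom_group_iff[OF C] by blast
  next
    assume R: ?R
    have "diag2 X Y \<in> carrier (GL (n + m))"
      using R diag2_GL_iff[OF X Y] unfolding isom_group_iff[OF B] isom_group_iff[OF C] by blast
    moreover have "form_val \<kappa> q (diag2 B C) (u * diag2 X Y) (v * diag2 X Y) = form_val \<kappa> q (diag2 B C) u v"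
      if uv: "u \<in> rows_space (n + m)" "v \<in> rows_space (n + m)" for u v
    proof -
      obtain u1 u2 where u: "u1 \<in> rows_space n" "u2 \<in> rows_space m" "u = row_append u1 u2"
        using rows_space_append[OF uv(1)] .
      obtain v1 v2 where v: "v1 \<in> rows_space n" "v2 \<in> rows_space m" "v = row_append v1 v2"
        using rows_space_append[OF uv(2)] .
      show ?thesis
        unfolding u(3) v(3) val[OF u(1,2) v(1,2)] form_val_diag2[OF u(1,2) v(1,2) B C]
        using R u(1,2) v(1,2) unfolding isom_group_iff[OF B] isom_group_iff[OF C] by metis
    qed
    ultimately show ?L unfolding isom_group_iff[OF BC] by blast
  qed
qed

section \<open>Lists of diagonal blocks of prescribed sizes\<close>

abbreviation blocks :: "nat list \<Rightarrow> 'a mat list \<Rightarrow> bool" where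
  "blocks \<equiv> list_all2 (\<lambda>n A. A \<in> carrier_mat n n)"

text \<open>Base case of the inductions over blocks: the empty list gives the 0 by 0 zero matrix,
  which has to be recognized as a group identity.\<close>

lemma one_mat_0: "1\<^sub>m 0 = 0\<^sub>m 0 0"
  by (rule eq_matI) auto

lemma one_mat_GL: "1\<^sub>m n \<in> carrier (GL n)"
  by (simp add: carrier_GL_iff)

lemma diag_block_mat_carrier: "blocks ns As \<Longrightarrow> diag_block_mat As \<in> carrier_mat (sum_list ns) (sum_list ns)"
proof (induction rule: list_all2_induct)
  case (Cons n ns A As)
  then show ?case
    unfolding diag_block_mat_Cons using four_block_carrier_mat[OF Cons(1) Cons.IH] by simp
qed simp

lemma blocks_mult: "blocks ns As \<Longrightarrow> blocks ns Bs \<Longrightarrow> blocks ns (map2 (*) As Bs)"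
  by (auto simp: list_all2_conv_all_nth)

lemma diag_block_mat_mult:
  fixes As Bs :: "'a::field mat list"
  assumes "blocks ns As" "blocks ns Bs"
  shows "diag_block_mat As * diag_block_mat Bs = diag_block_mat (map2 (*) As Bs)"
  using assms
proof (induction arbitrary: Bs rule: list_all2_induct)
  case (Cons n ns A As)
  then obtain B Bs' where B: "Bs = B # Bs'" "B \<in> carrier_mat n n" "blocks ns Bs'"
    by (auto simp: list_all2_Cons1)
  show ?case
    using diag2_mult[OF Cons(1) B(2) diag_block_mat_carrier[OF Cons(2)] diag_block_mat_carrier[OF B(3)]]
      Cons.IH[OF B(3)] B(1) by (simp add: diag_block_mat_Cons del: diag_block_mat.simps)
qed simp

text \<open>The common list of sizes is what makes this true: the same block diagonal matrix can be
  cut into blocks in several ways.\<close>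

lemma diag_block_mat_inject:
  assumes "blocks ns As" "blocks ns Bs" "diag_block_mat As = diag_block_mat Bs"
  shows "As = Bs"
  using assms
proof (induction arbitrary: Bs rule: list_all2_induct)
  case (Cons n ns A As)
  then obtain B Bs' where B: "Bs = B # Bs'" "B \<in> carrier_mat n n" "blocks ns Bs'"
    by (auto simp: list_all2_Cons1)
  have "diag2 A (diag_block_mat As) = diag2 B (diag_block_mat Bs')"
    using Cons.prems(2) unfolding B(1) diag_block_mat_Cons .
  from diag2_inject[OF Cons(1) B(2) diag_block_mat_carrier[OF Cons(2)] diag_block_mat_carrier[OF B(3)] this]
  show ?case using Cons.IH[OF B(3)] B(1) by simp
qed simp

lemma diag_block_mat_GL_iff:
  fixes As :: "'a::field mat list"
  assumes "blocks ns As"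
  shows "diag_block_mat As \<in> carrier (GL (sum_list ns)) \<longleftrightarrow> list_all2 (\<lambda>n A. A \<in> carrier (GL n)) ns As"
  using assms
proof (induction rule: list_all2_induct)
  case Nil
  then show ?case using one_mat_GL[of 0] by (simp add: one_mat_0)
next
  case (Cons n ns A As)
  then show ?case
    using diag2_GL_iff[OF Cons(1) diag_block_mat_carrier[OF Cons(2)]]
    by (simp add: diag_block_mat_Cons del: diag_block_mat.simps)
qed

lemma diag_block_mat_unipotent_iff:
  fixes As :: "'a::{field,finite} mat list"
  assumes "list_all2 (\<lambda>n A. A \<in> carrier (GL n)) ns As"
  shows "unipotent (diag_block_mat As) \<longleftrightarrow> (\<forall>A\<in>set As. unipotent A)"
  using assms
proof (induction rule: list_all2_induct)
  case Nil
  have "unipotent (1\<^sub>m 0 :: 'a mat)"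
    using one_mat_GL[of 0, where 'a = 'a] monoid.nat_pow_one[OF group.is_monoid[OF group_GL], of 0] by (auto simp: unipotent_iff[of _ 0])
  then show ?case by (simp add: one_mat_0)
next
  case (Cons n ns A As)
  have "blocks ns As" using Cons(2) by (rule list_all2_mono) (rule GL_carrier_mat)
  then have "diag_block_mat As \<in> carrier (GL (sum_list ns))" using diag_block_mat_GL_iff Cons(2) by blast
  then show ?case
    using diag2_unipotent_iff[OF Cons(1)] Cons.IH
    by (simp add: diag_block_mat_Cons del: diag_block_mat.simps)
qed

lemma diag_block_mat_isom_group_iff:
  fixes Bs :: "'a::field mat list"
  assumes "blocks ns Bs" "blocks ns Xs"
  shows "diag_block_mat Xs \<in> isom_group \<kappa> q (diag_block_mat Bs) \<longleftrightarrow>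
    list_all2 (\<lambda>B X. X \<in> isom_group \<kappa> q B) Bs Xs"
  using assms
proof (induction arbitrary: Xs rule: list_all2_induct)
  case Nil
  then show ?case
    using subgroup.one_closed[OF subgroup_isom_group[of \<kappa> q "0\<^sub>m 0 0 :: 'a mat"]] by (simp add: one_mat_0)
next
  case (Cons n ns B Bs)
  then obtain X Xs' where X: "Xs = X # Xs'" "X \<in> carrier_mat n n" "blocks ns Xs'"
    by (auto simp: list_all2_Cons1)
  show ?case
    using diag2_isom_group_iff[OF Cons(1) diag_block_mat_carrier[OF Cons(2)] X(2) diag_block_mat_carrier[OF X(3)]]
      Cons.IH[OF X(3)] X(1) by (simp add: diag_block_mat_Cons del: diag_block_mat.simps)
qed

text \<open>Products are formed block by block and the blocks of a matrix are determined by it.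
  Applied to commutation and to conjugacy, this is the source of the independent choice of the
  unipotent blocks.\<close>

lemma diag_block_mat_intertwine_iff:
  fixes As Bs Cs Ds :: "'a::field mat list"
  assumes "blocks ns As" "blocks ns Bs" "blocks ns Cs" "blocks ns Ds"
  shows "diag_block_mat As * diag_block_mat Bs = diag_block_mat Cs * diag_block_mat Ds \<longleftrightarrow>
    (\<forall>i<length ns. As ! i * Bs ! i = Cs ! i * Ds ! i)"
proof -
  have len: "length As = length ns" "length Bs = length ns" "length Cs = length ns" "length Ds = length ns"
    using assms by (auto dest: list_all2_lengthD)
  have "diag_block_mat As * diag_block_mat Bs = diag_block_mat Cs * diag_block_mat Ds \<longleftrightarrow>
      map2 (*) As Bs = map2 (*) Cs Ds"
    using diag_block_mat_mult[OF assms(1,2)] diag_block_mat_mult[OF assms(3,4)]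
      diag_block_mat_inject[OF blocks_mult[OF assms(1,2)] blocks_mult[OF assms(3,4)]] by auto
  also have "\<dots> \<longleftrightarrow> (\<forall>i<length ns. As ! i * Bs ! i = Cs ! i * Ds ! i)"
    using len by (auto simp: list_eq_iff_nth_eq)
  finally show ?thesis .
qed

text \<open>One half of the direct product decomposition, for matrices already known to be block
  diagonal; \<open>commutant_block_diagonal\<close> shows that the centralizer contains no
  others.\<close>

lemma diag_block_mat_centralizer_iff:
  fixes Bs :: "'a::field mat list"
  assumes "blocks ns Bs" "blocks ns Ss" "blocks ns Xs"
  shows "diag_block_mat Xs \<in> centralizer (isom_group \<kappa> q (diag_block_mat Bs)) (diag_block_mat Ss) \<longleftrightarrow>
    (\<forall>i<length ns. Xs ! i \<in> centralizer (isom_group \<kappa> q (Bs ! i)) (Ss ! i))"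
  using diag_block_mat_isom_group_iff[OF assms(1,3)] diag_block_mat_intertwine_iff[OF assms(3,2,2,3)]
    assms[THEN list_all2_lengthD]
  by (auto simp: centralizer_def list_all2_conv_all_nth)

section \<open>Block diagonality of the matrices commuting with the semisimple part\<close>

lemma ex_block_index:
  "j < sum_list ns \<Longrightarrow> \<exists>i<length ns. sum_list (take i ns) \<le> j \<and> j < sum_list (take (Suc i) (ns :: nat list))"
proof (induction ns arbitrary: j)
  case (Cons n ns)
  show ?case
  proof (cases "j < n")
    case False
    then have "j - n < sum_list ns" using Cons.prems by auto
    then obtain i where "i < length ns" "sum_list (take i ns) \<le> j - n" "j - n < sum_list (take (Suc i) ns)"
      using Cons.IH by blast
    then show ?thesis using False by (intro exI[of _ "Suc i"]) auto
  qed auto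
qed simp

text \<open>The condition is put on rows because a row of \<open>X\<close> is the image of a
  standard basis vector. Peeling off the first block leaves a corner that satisfies the same
  condition.\<close>

lemma ex_diag_block_mat:
  fixes X :: "'a::zero mat"
  assumes "X \<in> carrier_mat (sum_list ns) (sum_list ns)"
    and "\<And>i j k. i < length ns \<Longrightarrow> sum_list (take i ns) \<le> j \<Longrightarrow> j < sum_list (take (Suc i) ns) \<Longrightarrow>
      k < sum_list ns \<Longrightarrow> X $$ (j, k) \<noteq> 0 \<Longrightarrow> sum_list (take i ns) \<le> k \<and> k < sum_list (take (Suc i) ns)"
  shows "\<exists>Xs. blocks ns Xs \<and> X = diag_block_mat Xs"
  using assms
proof (induction ns arbitrary: X)
  case (Cons n ns)
  let ?N = "sum_list ns"
  define A where "A = mat n n (\<lambda>(i, j). X $$ (i, j))"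
  define D where "D = mat ?N ?N (\<lambda>(i, j). X $$ (n + i, n + j))"
  have "\<exists>Ds. blocks ns Ds \<and> D = diag_block_mat Ds"
  proof (rule Cons.IH)
    fix i j k
    assume i: "i < length ns" and j: "sum_list (take i ns) \<le> j" "j < sum_list (take (Suc i) ns)"
      and k: "k < ?N" and nz: "D $$ (j, k) \<noteq> 0"
    have "sum_list (take (Suc i) ns) \<le> ?N"
      using append_take_drop_id[of "Suc i" ns] sum_list_append by (metis le_add1)
    then have "X $$ (n + j, n + k) \<noteq> 0" using nz j k by (simp add: D_def)
    then show "sum_list (take i ns) \<le> k \<and> k < sum_list (take (Suc i) ns)"
      using Cons.prems(2)[of "Suc i" "n + j" "n + k"] i j k by simp
  qed (simp add: D_def)
  then obtain Ds where Ds: "blocks ns Ds" "D = diag_block_mat Ds" by blast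
  have right: "X $$ (j, k) = 0" if "j < n" "n \<le> k" "k < n + ?N" for j k
    using Cons.prems(2)[of 0 j k] that by auto
  \<comment> \<open>A row below the first block has to be located in its own block before the
    hypothesis can be used; all columns of that block start at \<open>n\<close> or later.\<close>
  have left: "X $$ (j, k) = 0" if j: "n \<le> j" "j < n + ?N" "k < n" for j k
  proof -
    have "j - n < sum_list ns" using j by linarith
    then obtain i where i: "i < length ns" "sum_list (take i ns) \<le> j - n" "j - n < sum_list (take (Suc i) ns)"
      using ex_block_index by blast
    then have "n + sum_list (take i ns) \<le> j" "j < n + sum_list (take (Suc i) ns)" using j by linarith+
    then show ?thesis using Cons.prems(2)[of "Suc i" j k] i(1) j by auto
  qed
  have "X = diag2 A D"
  proof (rule eq_matI)
    fix i j assume "i < dim_row (diag2 A D)" "j < dim_col (diag2 A D)"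
    then have ij: "i < n + ?N" "j < n + ?N" by (simp_all add: A_def D_def)
    then show "X $$ (i, j) = diag2 A D $$ (i, j)"
      using left right by (auto simp: A_def D_def)
  qed (use Cons.prems(1) in \<open>auto simp: A_def D_def\<close>)
  then show ?case
    using Ds by (intro exI[of _ "A # Ds"]) (simp add: diag_block_mat_Cons A_def del: diag_block_mat.simps)
qed auto

lemma commute_pow_mat:
  fixes X S :: "'a::field mat"
  assumes "X \<in> carrier_mat n n" "S \<in> carrier_mat n n" "X * S = S * X"
  shows "X * (S ^\<^sub>m k) = (S ^\<^sub>m k) * X"
proof (induction k)
  case (Suc k)
  have c: "S ^\<^sub>m k \<in> carrier_mat n n" using assms(2) by (rule pow_carrier_mat)
  have "X * (S ^\<^sub>m k * S) = X * S ^\<^sub>m k * S" using assoc_mult_mat[OF assms(1) c assms(2)] by simp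
  also have "\<dots> = S ^\<^sub>m k * (X * S)" unfolding Suc using assoc_mult_mat[OF c assms(1,2)] .
  also have "\<dots> = S ^\<^sub>m k * S * X" unfolding assms(3) using assoc_mult_mat[OF c assms(2,1)] by simp
  finally show ?case by simp
qed (use assms in simp)

lemma commute_poly_at_mat:
  fixes X S :: "'a::field mat"
  assumes "X \<in> carrier_mat n n" "S \<in> carrier_mat n n" "X * S = S * X"
  shows "X * poly_at_mat f S = poly_at_mat f S * X"
proof (rule eq_matI)
  fix r c assume "r < dim_row (poly_at_mat f S * X)" "c < dim_col (poly_at_mat f S * X)"
  then have rc: "r < n" "c < n" using assms by (auto simp: poly_at_mat_def)
  let ?c = "Polynomial.coeff f" and ?d = "Polynomial.degree f"
  have "(X * poly_at_mat f S) $$ (r, c) = (\<Sum>l<n. \<Sum>i\<le>?d. ?c i * (X $$ (r, l) * (S ^\<^sub>m i) $$ (l, c)))"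
    using rc assms(1,2) by (simp add: poly_at_mat_def scalar_prod_def atLeast0LessThan sum_distrib_left ac_simps)
  also have "\<dots> = (\<Sum>i\<le>?d. ?c i * (X * S ^\<^sub>m i) $$ (r, c))"
    using rc assms(1,2)
    by (subst sum.swap) (simp add: scalar_prod_def atLeast0LessThan sum_distrib_left)
  also have "\<dots> = (\<Sum>i\<le>?d. ?c i * (S ^\<^sub>m i * X) $$ (r, c))"
    unfolding commute_pow_mat[OF assms] ..
  also have "\<dots> = (\<Sum>l<n. \<Sum>i\<le>?d. ?c i * ((S ^\<^sub>m i) $$ (r, l) * X $$ (l, c)))"
    using rc assms(1,2)
    by (subst sum.swap) (simp add: scalar_prod_def atLeast0LessThan sum_distrib_left)
  also have "\<dots> = (poly_at_mat f S * X) $$ (r, c)"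
    using rc assms(1,2)
    by (simp add: poly_at_mat_def scalar_prod_def atLeast0LessThan sum_distrib_right sum_distrib_left ac_simps)
  finally show "(X * poly_at_mat f S) $$ (r, c) = (poly_at_mat f S * X) $$ (r, c)" .
qed (use assms in \<open>auto simp: poly_at_mat_def\<close>)

text \<open>The unit row vector \<open>v\<close> at position \<open>j\<close> of block
  \<open>i\<close> is annihilated by \<open>K\<close>, the matrix of the i-th divisor evaluated at
  \<open>S\<close>. Since \<open>X\<close> commutes with \<open>K\<close>, so is
  \<open>v * X\<close>, which is row \<open>j\<close> of \<open>X\<close>; being in the kernel, this
  row is supported on block \<open>i\<close>.\<close>

lemma commutant_block_diagonal:
  fixes X :: "'a::field mat"
  assumes Ss: "blocks ns Ss" and S: "S = diag_block_mat Ss"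
    and ker: "\<And>i. i < length Ss \<Longrightarrow> row_kernel (poly_at_mat (fs ! i) S) = block_space Ss i"
    and X: "X \<in> carrier_mat (sum_list ns) (sum_list ns)" and comm: "X * S = S * X"
  shows "\<exists>Xs. blocks ns Xs \<and> X = diag_block_mat Xs"
proof (rule ex_diag_block_mat[OF X])
  let ?n = "sum_list ns"
  fix i j k
  assume i: "i < length ns" and j: "sum_list (take i ns) \<le> j" "j < sum_list (take (Suc i) ns)"
    and k: "k < ?n" and nz: "X $$ (j, k) \<noteq> 0"
  have ns: "map dim_row Ss = ns"
    using Ss by (auto simp: list_all2_conv_all_nth intro!: nth_equalityI)
  have "sum_list (take (Suc i) ns) \<le> ?n"
    using append_take_drop_id[of "Suc i" ns] sum_list_append by (metis le_add1)
  then have jn: "j < ?n" using j by simp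
  have Sc: "S \<in> carrier_mat ?n ?n" using diag_block_mat_carrier[OF Ss] S by simp
  define K where "K = poly_at_mat (fs ! i) S"
  have K: "K \<in> carrier_mat ?n ?n" using Sc by (auto simp: K_def poly_at_mat_def)
  have ker_i: "row_kernel K = block_space Ss i" using ker[of i] i ns by (auto simp: K_def)
  define v :: "'a mat" where "v = mat 1 ?n (\<lambda>(_, l). if l = j then 1 else 0)"
  have v: "v \<in> carrier_mat 1 ?n" by (simp add: v_def)
  have "v \<in> block_space Ss i"
    using j by (auto simp: block_space_def ns take_map[symmetric] v_def split: if_splits)
  then have "v * K = 0\<^sub>m 1 ?n" using K unfolding ker_i[symmetric] by (simp add: row_kernel_def)
  moreover have "v * X * K = v * K * X"
    using assoc_mult_mat[OF v X K] assoc_mult_mat[OF v K X] commute_poly_at_mat[OF X Sc comm]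
    by (simp add: K_def)
  ultimately have "v * X * K = 0\<^sub>m 1 ?n" using X by simp
  then have "v * X \<in> row_kernel K" using K v X by (simp add: row_kernel_def)
  moreover have "(v * X) $$ (0, k) = (\<Sum>l<?n. if l = j then X $$ (l, k) else 0)"
    using v X k jn
    by (simp add: scalar_prod_def atLeast0LessThan v_def mult_delta_left)
  then have "(v * X) $$ (0, k) = X $$ (j, k)" using jn by simp
  ultimately show "sum_list (take i ns) \<le> k \<and> k < sum_list (take (Suc i) ns)"
    using nz k unfolding ker_i by (auto simp: block_space_def ns take_map[symmetric])
qed

section \<open>Classes of pairs\<close>

lemma isom_group_carrier: "B \<in> carrier_mat n n \<Longrightarrow> X \<in> isom_group \<kappa> q B \<Longrightarrow> X \<in> carrier (GL n)"
  by (simp add: isom_group_iff)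

lemma isometries_carrier: "B \<in> carrier_mat n n \<Longrightarrow> P \<in> isometries \<kappa> q B C \<Longrightarrow> P \<in> carrier (GL n)"
  using isometries_GL by fastforce

lemma GL_intertwine_cancel:
  fixes P X :: "'a::field mat"
  assumes "P \<in> carrier (GL n)" "X \<in> carrier_mat n n"
  shows "P * (mat_inv P * X * P) = X * P" "P * X * mat_inv P * P = P * X"
proof -
  have P: "P \<in> carrier_mat n n" "mat_inv P \<in> carrier_mat n n"
    using assms(1) mat_inv_GL(1) GL_carrier_mat by blast+
  have "P * (mat_inv P * X * P) = P * mat_inv P * (X * P)"
    using P assms(2) by (simp add: assoc_mult_mat[of _ n n _ n _ n])
  then show "P * (mat_inv P * X * P) = X * P" using mat_inv_GL(3)[OF assms(1)] P assms(2) by simp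
  have "P * X * mat_inv P * P = P * X * (mat_inv P * P)"
    using P assms(2) by (simp add: assoc_mult_mat[of _ n n _ n _ n])
  then show "P * X * mat_inv P * P = P * X" using mat_inv_GL(2)[OF assms(1)] P assms(2) by simp
qed

lemma intertwine_trans:
  fixes P Q X Y W :: "'a::field mat"
  assumes "{P, Q, X, Y, W} \<subseteq> carrier_mat n n" "P * Y = X * P" "Q * W = Y * Q"
  shows "(P * Q) * W = X * (P * Q)"
proof -
  have "(P * Q) * W = P * (Q * W)" using assms(1) by (simp add: assoc_mult_mat[of _ n n _ n _ n])
  also have "\<dots> = P * Y * Q" unfolding assms(3) using assms(1) by (simp add: assoc_mult_mat[of _ n n _ n _ n])
  also have "\<dots> = X * (P * Q)" unfolding assms(2) using assms(1) by (simp add: assoc_mult_mat[of _ n n _ n _ n])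
  finally show ?thesis .
qed

lemma intertwine_mult:
  fixes P S U S' U' :: "'a::field mat"
  assumes "{P, S, U, S', U'} \<subseteq> carrier_mat n n" "P * S = S' * P" "P * U = U' * P"
  shows "P * (S * U) = S' * U' * P"
proof -
  have "P * (S * U) = P * S * U" using assms(1) by (simp add: assoc_mult_mat[of _ n n _ n _ n])
  also have "\<dots> = S' * (P * U)" unfolding assms(2) using assms(1) by (simp add: assoc_mult_mat[of _ n n _ n _ n])
  also have "\<dots> = S' * U' * P" unfolding assms(3) using assms(1) by (simp add: assoc_mult_mat[of _ n n _ n _ n])
  finally show ?thesis .
qed

lemma intertwine_mat_inv:
  fixes P X Y :: "'a::field mat"
  assumes "P \<in> carrier (GL n)" "X \<in> carrier_mat n n" "Y \<in> carrier_mat n n" "P * Y = X * P"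
  shows "mat_inv P * X = Y * mat_inv P"
proof -
  note i = mat_inv_GL[OF assms(1)]
  have P: "P \<in> carrier_mat n n" "mat_inv P \<in> carrier_mat n n"
    using assms(1) i(1) GL_carrier_mat by blast+
  have "mat_inv P * X = mat_inv P * (X * P) * mat_inv P"
    using P assms(2) i(3) by (simp add: assoc_mult_mat[of _ n n _ n _ n])
  also have "\<dots> = mat_inv P * P * Y * mat_inv P"
    unfolding assms(4)[symmetric] using P assms(3) by (simp add: assoc_mult_mat[of _ n n _ n _ n])
  also have "\<dots> = Y * mat_inv P" using i(2) assms(3) by simp
  finally show ?thesis .
qed

lemma isometries_pullback:
  assumes "dim_row B = dim_row B\<^sub>0" "P \<in> isometries \<kappa> q B\<^sub>0 B" "X \<in> isom_group \<kappa> q B"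
  shows "mat_inv P * X * P \<in> isom_group \<kappa> q B\<^sub>0"
proof -
  have "mat_inv P * X \<in> isometries \<kappa> q B B\<^sub>0"
    using isometries_mult[OF _ isometries_inv[OF assms(2,1)], of X] assms(3) by (simp add: isom_group_eq)
  then show ?thesis using isometries_mult[OF assms(2)] assms(1) by (simp add: isom_group_eq)
qed

text \<open>The isometries from \<open>B\<^sub>0\<close> to \<open>B\<close> form a coset of the
  isometry group of \<open>B\<^sub>0\<close>: each is \<open>P * Z\<close> with \<open>Z\<close> in
  that group. Substituting \<open>Q = P * Z\<close> turns conjugacy of the pulled-back element into
  a condition in which \<open>P\<close> no longer occurs.\<close>

lemma conj_class_pullback_eq_iff:
  assumes B\<^sub>0: "B\<^sub>0 \<in> carrier_mat n n" and dB: "B \<in> carrier_mat n n"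
    and P: "P \<in> isometries \<kappa> q B\<^sub>0 B"
    and X: "X \<in> isom_group \<kappa> q B" and Y: "Y \<in> isom_group \<kappa> q B\<^sub>0"
  shows "conj_class (isom_group \<kappa> q B\<^sub>0) (mat_inv P * X * P) = conj_class (isom_group \<kappa> q B\<^sub>0) Y \<longleftrightarrow>
    (\<exists>Q\<in>isometries \<kappa> q B\<^sub>0 B. Q * Y = X * Q)"
proof -
  let ?G = "isom_group \<kappa> q B\<^sub>0"
  have sub: "subgroup ?G (GL n)" using subgroup_isom_group[of \<kappa> q B\<^sub>0] B\<^sub>0 by simp
  have XG: "X \<in> carrier (GL n)" using isom_group_carrier[OF dB X] .
  have YG: "Y \<in> carrier (GL n)" using isom_group_carrier[OF B\<^sub>0 Y] .
  have c: "X \<in> carrier_mat n n" "Y \<in> carrier_mat n n" using XG YG GL_carrier_mat by blast+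
  have PG: "P \<in> carrier (GL n)" using isometries_carrier[OF B\<^sub>0 P] .
  have c': "P \<in> carrier_mat n n" "mat_inv P \<in> carrier_mat n n"
    using PG mat_inv_GL(1) GL_carrier_mat by blast+
  let ?X = "mat_inv P * X * P"
  have XcG: "?X \<in> carrier (GL n)"
    using monoid.m_closed[OF group.is_monoid[OF group_GL]] mat_inv_GL(1)[OF PG] XG PG by (metis GL_mult)
  have Xc: "?X \<in> carrier_mat n n" using c c' by auto
  have PX: "P * ?X = X * P" using GL_intertwine_cancel(1)[OF PG c(1)] .
  show ?thesis
    unfolding conj_class_eq_iff[OF sub XcG YG]
  proof
    assume "\<exists>Z\<in>?G. Z * Y = ?X * Z"
    then obtain Z where Z: "Z \<in> ?G" "Z * Y = ?X * Z" by blast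
    have "Z \<in> carrier_mat n n" using isom_group_carrier[OF B\<^sub>0 Z(1)] GL_carrier_mat by blast
    then have "(P * Z) * Y = X * (P * Z)" using intertwine_trans[OF _ PX Z(2), of n] c c' Xc by simp
    moreover have "P * Z \<in> isometries \<kappa> q B\<^sub>0 B"
      using isometries_mult[OF _ P, of Z] Z(1) by (simp add: isom_group_eq)
    ultimately show "\<exists>Q\<in>isometries \<kappa> q B\<^sub>0 B. Q * Y = X * Q" by blast
  next
    assume "\<exists>Q\<in>isometries \<kappa> q B\<^sub>0 B. Q * Y = X * Q"
    then obtain Q where Q: "Q \<in> isometries \<kappa> q B\<^sub>0 B" "Q * Y = X * Q" by blast
    have Qc: "Q \<in> carrier_mat n n" using isometries_carrier[OF B\<^sub>0 Q(1)] GL_carrier_mat by blast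
    have "(mat_inv P * Q) * Y = ?X * (mat_inv P * Q)"
      using intertwine_trans[OF _ intertwine_mat_inv[OF PG c(1) Xc PX] Q(2), of n] c c' Xc Qc by simp
    moreover have "mat_inv P * Q \<in> ?G"
      using isometries_mult[OF Q(1) isometries_inv[OF P]] dB B\<^sub>0 by (simp add: isom_group_eq)
    ultimately show "\<exists>Z\<in>?G. Z * Y = ?X * Z" by blast
  qed
qed

text \<open>All choices of \<open>P\<close> in the definition of the class of a pair are isometries between the same
  two forms, so they yield the same class.\<close>

lemma pair_class_eq_conj_class:
  fixes B\<^sub>0 :: "'a::{field,finite} mat"
  assumes card: "CARD('a) = (if \<kappa> = Hermitian then q\<^sup>2 else q)"
    and B\<^sub>0: "B\<^sub>0 \<in> carrier_mat n n" and P: "congruent_via \<kappa> q P B\<^sub>0 B"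
    and X: "X \<in> isom_group \<kappa> q B"
  shows "pair_class \<kappa> q B\<^sub>0 (X, B) = conj_class (isom_group \<kappa> q B\<^sub>0) (mat_inv P * X * P)"
proof -
  let ?G = "isom_group \<kappa> q B\<^sub>0"
  have dB: "B \<in> carrier_mat n n" using P B\<^sub>0 by (simp add: congruent_via_def)
  have iso: "P' \<in> isometries \<kappa> q B\<^sub>0 B" if "congruent_via \<kappa> q P' B\<^sub>0 B" for P'
    using congruent_via_isometry[OF card B\<^sub>0 that] .
  have Y: "mat_inv P * X * P \<in> ?G"
    using isometries_pullback[OF _ iso[OF P] X] dB B\<^sub>0 by simp
  have "conj_class ?G (mat_inv P' * X * P') = conj_class ?G (mat_inv P * X * P)"
    if "congruent_via \<kappa> q P' B\<^sub>0 B" for P'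
    using conj_class_pullback_eq_iff[OF B\<^sub>0 dB iso[OF that] X Y]
      conj_class_pullback_eq_iff[OF B\<^sub>0 dB iso[OF P] X Y] by blast
  then show ?thesis using P unfolding pair_class_def prod.case by (intro UN_constant_eq) blast+
qed

text \<open>The working criterion for classes of pairs: it replaces the union over all congruences
  by a single intertwining isometry.\<close>

lemma pair_class_eq_iff:
  fixes B\<^sub>0 :: "'a::{field,finite} mat"
  assumes card: "CARD('a) = (if \<kappa> = Hermitian then q\<^sup>2 else q)"
    and B\<^sub>0: "B\<^sub>0 \<in> carrier_mat n n" and XB: "(X, B) \<in> form_pairs \<kappa> q B\<^sub>0"
    and Y: "Y \<in> isom_group \<kappa> q B\<^sub>0"
  shows "pair_class \<kappa> q B\<^sub>0 (X, B) = conj_class (isom_group \<kappa> q B\<^sub>0) Y \<longleftrightarrow>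
    (\<exists>Q\<in>isometries \<kappa> q B\<^sub>0 B. Q * Y = X * Q)"
proof -
  obtain P where P: "congruent_via \<kappa> q P B\<^sub>0 B" and X: "X \<in> isom_group \<kappa> q B"
    using XB by (auto simp: form_pairs_def)
  have dB: "B \<in> carrier_mat n n" using P B\<^sub>0 by (simp add: congruent_via_def)
  show ?thesis
    using pair_class_eq_conj_class[OF card B\<^sub>0 P X]
      conj_class_pullback_eq_iff[OF B\<^sub>0 dB congruent_via_isometry[OF card B\<^sub>0 P] X Y] by simp
qed

text \<open>This supplies an element of the group of \<open>B\<^sub>0\<close> at which two pairs
  with different forms can be compared.\<close>

lemma pair_class_conj_class:
  fixes B\<^sub>0 :: "'a::{field,finite} mat"
  assumes card: "CARD('a) = (if \<kappa> = Hermitian then q\<^sup>2 else q)"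
    and B\<^sub>0: "B\<^sub>0 \<in> carrier_mat n n" and XB: "(X, B) \<in> form_pairs \<kappa> q B\<^sub>0"
  obtains Y where "Y \<in> isom_group \<kappa> q B\<^sub>0" "pair_class \<kappa> q B\<^sub>0 (X, B) = conj_class (isom_group \<kappa> q B\<^sub>0) Y"
proof -
  obtain P where P: "congruent_via \<kappa> q P B\<^sub>0 B" and X: "X \<in> isom_group \<kappa> q B"
    using XB by (auto simp: form_pairs_def)
  have "B \<in> carrier_mat n n" using P B\<^sub>0 by (simp add: congruent_via_def)
  then have dim: "dim_row B = dim_row B\<^sub>0" using B\<^sub>0 by simp
  show ?thesis
    by (rule that[OF isometries_pullback[OF dim congruent_via_isometry[OF card B\<^sub>0 P] X]
          pair_class_eq_conj_class[OF card B\<^sub>0 P X]])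
qed

text \<open>Conjugating \<open>S\<close> and \<open>U\<close> back by \<open>Q\<close> gives a
  second decomposition of \<open>S0 * U0\<close> into commuting semisimple and unipotent factors.
  Uniqueness identifies it with the first, so one equation for the products splits into one for each
  factor.\<close>

lemma jordan_decomposition_transport:
  fixes Q :: "'a::{field,finite} mat"
  assumes Q: "Q \<in> carrier (GL n)" and G: "{S0, U0, S, U} \<subseteq> carrier (GL n)"
    and "S0 * U0 = U0 * S0" "S * U = U * S"
    and "semisimple S0" "semisimple S" "unipotent U0" "unipotent U"
    and eq: "Q * (S0 * U0) = S * U * Q"
  shows "Q * S0 = S * Q" "Q * U0 = U * Q"
proof -
  note mc = monoid.m_closed[OF group.is_monoid[OF group_GL], simplified]
  let ?S = "mat_inv Q * S * Q" and ?U = "mat_inv Q * U * Q"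
  have gs: "S0 \<in> carrier (GL n)" "U0 \<in> carrier (GL n)" "S \<in> carrier (GL n)" "U \<in> carrier (GL n)"
    using G by auto
  have c: "Q \<in> carrier_mat n n" "mat_inv Q \<in> carrier_mat n n" "S0 \<in> carrier_mat n n" "U0 \<in> carrier_mat n n"
    "S \<in> carrier_mat n n" "U \<in> carrier_mat n n"
    using Q mat_inv_GL(1)[OF Q] gs GL_carrier_mat by blast+
  have SU: "?S \<in> carrier (GL n)" "?U \<in> carrier (GL n)"
    using mc mat_inv_GL(1)[OF Q] Q gs by blast+
  have cSU: "?S \<in> carrier_mat n n" "?U \<in> carrier_mat n n" using SU GL_carrier_mat by blast+
  have QS: "Q * ?S = S * Q" "Q * ?U = U * Q"
    using GL_intertwine_cancel(1)[OF Q] c by blast+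
  have cancel: "A = B" if "A \<in> carrier_mat n n" "B \<in> carrier_mat n n" "Q * A = Q * B" for A B
  proof -
    have "A = mat_inv Q * (Q * A)" "B = mat_inv Q * (Q * B)"
      using mat_inv_GL(2)[OF Q] that(1,2) c(1,2) assoc_mult_mat[OF c(2,1)] left_mult_one_mat by metis+
    then show ?thesis using that(3) by simp
  qed
  have "Q * (?S * ?U) = S * U * Q" "Q * (?U * ?S) = U * S * Q"
    using intertwine_mult[OF _ QS, of n] intertwine_mult[OF _ QS(2,1), of n] c cSU by simp_all
  then have "?S * ?U = ?U * ?S" "S0 * U0 = ?S * ?U"
    using cancel[of "?S * ?U" "?U * ?S"] cancel[of "S0 * U0" "?S * ?U"] c cSU assms(4) eq
    by (metis mult_carrier_mat)+
  moreover have "semisimple ?S" "unipotent ?U"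
    using semisimple_conj[OF gs(3) SU(1) Q QS(1)] unipotent_conj[OF gs(4) SU(2) Q QS(2)] assms by blast+
  ultimately have "S0 = ?S" "U0 = ?U"
    using jordan_decomposition_unique[of S0 U0 ?S ?U n] gs SU assms by blast+
  then show "Q * S0 = S * Q" "Q * U0 = U * Q" using QS by simp_all
qed

section \<open>Unipotent classes of the centralizer, block by block\<close>

lemma unipotent_class_reps_iff:
  assumes H: "subgroup H (GL n)"
  shows "unipotent_class_reps H R \<longleftrightarrow> R \<subseteq> {X \<in> H. unipotent X} \<and>
    (\<forall>X\<in>H. unipotent X \<longrightarrow> (\<exists>U\<in>R. \<exists>Z\<in>H. Z * X = U * Z)) \<and>
    (\<forall>U\<in>R. \<forall>U'\<in>R. \<forall>Z\<in>H. Z * U = U' * Z \<longrightarrow> U = U')"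
\<comment> \<open>The criterion for equal classes is applied to members of \<open>H\<close>; when
  \<open>R\<close> is not contained in \<open>H\<close>, or has a member that is not unipotent, both
  sides fail.\<close>
proof (cases "R \<subseteq> {X \<in> H. unipotent X}")
  case True
  have eq: "conj_class H X = conj_class H Y \<longleftrightarrow> (\<exists>Z\<in>H. Z * Y = X * Z)" if "X \<in> H" "Y \<in> H" for X Y
    using conj_class_eq_iff[OF H] that H subgroup.mem_carrier by metis
  have RH: "U \<in> H" if "U \<in> R" for U using True that by blast
  have "conj_class H U = conj_class H U' \<longleftrightarrow> (\<exists>Z\<in>H. Z * U = U' * Z)" if "U \<in> R" "U' \<in> R" for U U'
    using eq[OF RH RH, OF that(2,1)] by (simp only: eq_commute[of "conj_class H U"])
  then have inj: "inj_on (conj_class H) R \<longleftrightarrow> (\<forall>U\<in>R. \<forall>U'\<in>R. \<forall>Z\<in>H. Z * U = U' * Z \<longrightarrow> U = U')"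
    by (auto simp: inj_on_def)
  have img: "conj_class H ` R = {conj_class H X | X. X \<in> H \<and> unipotent X} \<longleftrightarrow>
      (\<forall>X\<in>H. unipotent X \<longrightarrow> (\<exists>U\<in>R. \<exists>Z\<in>H. Z * X = U * Z))" (is "?I = ?C \<longleftrightarrow> ?E")
  proof
    assume IC: "?I = ?C"
    show ?E
    proof (intro ballI impI)
      fix X assume X: "X \<in> H" "unipotent X"
      then have "conj_class H X \<in> ?I" unfolding IC by blast
      then obtain U where U: "U \<in> R" "conj_class H U = conj_class H X" by (metis imageE)
      then have "\<exists>Z\<in>H. Z * X = U * Z" using eq[OF RH[OF U(1)] X(1)] by simp
      then show "\<exists>U\<in>R. \<exists>Z\<in>H. Z * X = U * Z" using U(1) by blast
    qed
  next
    assume E: ?E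
    have "conj_class H X \<in> ?I" if X: "X \<in> H" "unipotent X" for X
    proof -
      obtain U where U: "U \<in> R" "\<exists>Z\<in>H. Z * X = U * Z" using E X by blast
      then have "conj_class H X = conj_class H U" using eq[OF RH[OF U(1)] X(1)] by simp
      then show ?thesis using U(1) by (rule image_eqI)
    qed
    then show "?I = ?C" using True by blast
  qed
  show ?thesis unfolding unipotent_class_reps_def bij_betw_def inj img by (simp only: conj_ac)
qed (simp add: unipotent_class_reps_def)

text \<open>Conjugating elements must be treated in blocks as well. For completeness, conjugators
  found in each block are glued together; for irredundancy, a given conjugator is cut into
  blocks.\<close>

lemma unipotent_class_reps_diag_block_mat:
  fixes Ss Bs :: "'a::{field,finite} mat list"
  assumes adapted: "adapted_blocks \<kappa> q (S, B) Ss Bs"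
    and reps: "\<And>i. i < length Ss \<Longrightarrow>
      unipotent_class_reps (centralizer (isom_group \<kappa> q (Bs ! i)) (Ss ! i)) (Us i)"
  shows "unipotent_class_reps (centralizer (isom_group \<kappa> q B) S)
    (diag_block_mat ` {U. length U = length Ss \<and> (\<forall>i<length U. U ! i \<in> Us i)})"
proof -
  define ns where "ns = map dim_row Ss"
  define C where "C i = centralizer (isom_group \<kappa> q (Bs ! i)) (Ss ! i)" for i
  obtain fs where len: "length Bs = length Ss"
    and sq: "\<And>i. i < length Ss \<Longrightarrow> square_mat (Ss ! i) \<and> square_mat (Bs ! i) \<and> dim_row (Bs ! i) = dim_row (Ss ! i)"
    and SB: "S = diag_block_mat Ss" "B = diag_block_mat Bs"
    and ker: "\<And>i. i < length Ss \<Longrightarrow> row_kernel (poly_at_mat (fs ! i) S) = block_space Ss i"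
    using adapted unfolding adapted_blocks_def prod.case by blast
  have lns: "length ns = length Ss" by (simp add: ns_def)
  have bS: "blocks ns Ss" and bB: "blocks ns Bs"
  proof -
    have "Ss ! i \<in> carrier_mat (ns ! i) (ns ! i)" "Bs ! i \<in> carrier_mat (ns ! i) (ns ! i)"
      if "i < length ns" for i
    proof -
      have i: "i < length Ss" using that lns by simp
      then have "ns ! i = dim_row (Ss ! i)" by (simp add: ns_def)
      then show "Ss ! i \<in> carrier_mat (ns ! i) (ns ! i)" "Bs ! i \<in> carrier_mat (ns ! i) (ns ! i)"
        using sq[OF i] by (auto intro!: carrier_matI)
    qed
    then show "blocks ns Ss" "blocks ns Bs" using lns len by (auto intro!: list_all2_all_nthI)
  qed
  have Sc: "S \<in> carrier_mat (sum_list ns) (sum_list ns)" and Bc: "B \<in> carrier_mat (sum_list ns) (sum_list ns)"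
    using diag_block_mat_carrier[OF bS] diag_block_mat_carrier[OF bB] SB by auto
  let ?H = "centralizer (isom_group \<kappa> q B) S"
  have H: "subgroup ?H (GL (sum_list ns))"
    using subgroup_centralizer[OF _ Sc] subgroup_isom_group[of \<kappa> q B] Bc by simp
  have Ci: "subgroup (C i) (GL (ns ! i))" if "i < length ns" for i
  proof -
    have "Ss ! i \<in> carrier_mat (ns ! i) (ns ! i)" "dim_row (Bs ! i) = ns ! i"
      using bS bB that by (auto simp: list_all2_conv_all_nth)
    then show ?thesis
      using subgroup_centralizer subgroup_isom_group[of \<kappa> q "Bs ! i"] unfolding C_def by metis
  qed
  have reps_i: "Us i \<subseteq> {X \<in> C i. unipotent X}"
      "\<And>X. X \<in> C i \<Longrightarrow> unipotent X \<Longrightarrow> \<exists>U\<in>Us i. \<exists>Z\<in>C i. Z * X = U * Z"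
      "\<And>U U' Z. U \<in> Us i \<Longrightarrow> U' \<in> Us i \<Longrightarrow> Z \<in> C i \<Longrightarrow> Z * U = U' * Z \<Longrightarrow> U = U'"
    if "i < length ns" for i
  proof -
    have "unipotent_class_reps (C i) (Us i)" using reps[of i] that lns by (simp add: C_def)
    note r = this[unfolded unipotent_class_reps_iff[OF Ci[OF that]]]
    show "Us i \<subseteq> {X \<in> C i. unipotent X}" using r by (rule conjunct1)
    show "\<exists>U\<in>Us i. \<exists>Z\<in>C i. Z * X = U * Z" if "X \<in> C i" "unipotent X" for X
      using r that by simp
    show "U = U'" if "U \<in> Us i" "U' \<in> Us i" "Z \<in> C i" "Z * U = U' * Z" for U U' Z
      using conjunct2[OF conjunct2[OF r]] that by blast
  qed
  have mem: "diag_block_mat Xs \<in> ?H \<longleftrightarrow> (\<forall>i<length ns. Xs ! i \<in> C i)" if "blocks ns Xs" for Xs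
    using diag_block_mat_centralizer_iff[OF bB bS that] SB by (simp add: C_def)
  have GLI: "list_all2 (\<lambda>n A. A \<in> carrier (GL n)) ns Xs"
    if "length Xs = length ns" "\<And>i. i < length ns \<Longrightarrow> Xs ! i \<in> C i" for Xs
    using that Ci subgroup.mem_carrier by (fastforce simp: list_all2_conv_all_nth)
  have blocksI: "blocks ns Xs"
    if "length Xs = length ns" "\<And>i. i < length ns \<Longrightarrow> Xs ! i \<in> C i" for Xs
    by (rule list_all2_mono[OF GLI]) (use that in \<open>auto intro: GL_carrier_mat\<close>)
  have unip: "unipotent (diag_block_mat Xs) \<longleftrightarrow> (\<forall>i<length ns. unipotent (Xs ! i))"
    if "length Xs = length ns" "\<And>i. i < length ns \<Longrightarrow> Xs ! i \<in> C i" for Xs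
    using diag_block_mat_unipotent_iff[OF GLI, of Xs] that by (simp add: all_set_conv_all_nth)
  have decomp: "\<exists>Xs. length Xs = length ns \<and> (\<forall>i<length ns. Xs ! i \<in> C i) \<and> X = diag_block_mat Xs"
    if X: "X \<in> ?H" for X
  proof -
    have Xc: "X \<in> carrier_mat (sum_list ns) (sum_list ns)"
      using subgroup.mem_carrier[OF H X] by (rule GL_carrier_mat)
    have XS: "X * S = S * X" using X by (simp add: centralizer_def)
    have "\<exists>Xs. blocks ns Xs \<and> X = diag_block_mat Xs"
      by (rule commutant_block_diagonal[OF bS SB(1) _ Xc XS]) (rule ker)
    then obtain Xs where Xs: "blocks ns Xs" "X = diag_block_mat Xs" by (elim exE conjE)
    then show ?thesis using mem[OF Xs(1)] X list_all2_lengthD[OF Xs(1)] by (intro exI[of _ Xs]) simp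
  qed
  show ?thesis
    unfolding unipotent_class_reps_iff[OF H]
  proof (intro conjI subsetI ballI impI)
    fix V assume "V \<in> diag_block_mat ` {U. length U = length Ss \<and> (\<forall>i<length U. U ! i \<in> Us i)}"
    then obtain U where U: "length U = length ns" "\<And>i. i < length ns \<Longrightarrow> U ! i \<in> Us i" "V = diag_block_mat U"
      using lns by auto
    have UC: "U ! i \<in> C i" "unipotent (U ! i)" if "i < length ns" for i
      using U(2)[OF that] reps_i(1)[OF that] by blast+
    show "V \<in> {X \<in> ?H. unipotent X}"
      using mem[OF blocksI[OF U(1) UC(1)]] unip[OF U(1) UC(1)] UC U(3) by simp
  next
    fix X assume X: "X \<in> ?H" "unipotent X"
    obtain Xs where Xs: "length Xs = length ns" "\<And>i. i < length ns \<Longrightarrow> Xs ! i \<in> C i" "X = diag_block_mat Xs"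
      using decomp[OF X(1)] by blast
    have "\<exists>U Z. U \<in> Us i \<and> Z \<in> C i \<and> Z * Xs ! i = U * Z" if "i < length ns" for i
    proof -
      have "unipotent (Xs ! i)" using unip[OF Xs(1,2)] X(2) Xs(3) that by simp
      from reps_i(2)[OF that Xs(2)[OF that] this] show ?thesis by blast
    qed
    then obtain u z where uz: "u i \<in> Us i" "z i \<in> C i" "z i * Xs ! i = u i * z i" if "i < length ns" for i
      by metis
    define U Z where "U = map u [0..<length ns]" and "Z = map z [0..<length ns]"
    have U: "length U = length ns" "\<And>i. i < length ns \<Longrightarrow> U ! i = u i"
      and Z: "length Z = length ns" "\<And>i. i < length ns \<Longrightarrow> Z ! i = z i"
      by (simp_all add: U_def Z_def)
    have UC: "U ! i \<in> C i" and ZC: "Z ! i \<in> C i" if "i < length ns" for i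
      using subsetD[OF reps_i(1)[OF that] uz(1)[OF that]] U(2)[OF that] uz(2)[OF that] Z(2)[OF that] by simp_all
    have bl: "blocks ns U" "blocks ns Z" "blocks ns Xs"
      using blocksI[OF U(1) UC] blocksI[OF Z(1) ZC] blocksI[OF Xs(1,2)] by simp_all
    have "diag_block_mat Z * X = diag_block_mat U * diag_block_mat Z"
      unfolding Xs(3) diag_block_mat_intertwine_iff[OF bl(2,3,1,2)] using U Z uz by simp
    moreover have "diag_block_mat Z \<in> ?H" using mem[OF bl(2)] ZC by simp
    moreover have "U \<in> {U. length U = length Ss \<and> (\<forall>i<length U. U ! i \<in> Us i)}"
      using U uz lns by simp
    ultimately show "\<exists>V\<in>diag_block_mat ` {U. length U = length Ss \<and> (\<forall>i<length U. U ! i \<in> Us i)}.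
        \<exists>Z\<in>?H. Z * X = V * Z" by blast
  next
    fix V V' Z
    assume "V \<in> diag_block_mat ` {U. length U = length Ss \<and> (\<forall>i<length U. U ! i \<in> Us i)}"
      and "V' \<in> diag_block_mat ` {U. length U = length Ss \<and> (\<forall>i<length U. U ! i \<in> Us i)}"
      and Z: "Z \<in> ?H" and eq: "Z * V = V' * Z"
    then obtain U U' where U: "length U = length ns" "\<And>i. i < length ns \<Longrightarrow> U ! i \<in> Us i" "V = diag_block_mat U"
      and U': "length U' = length ns" "\<And>i. i < length ns \<Longrightarrow> U' ! i \<in> Us i" "V' = diag_block_mat U'"
      using lns by auto
    \<comment> \<open>Conjugacy of \<open>V\<close> and \<open>V'\<close> descends to every block
      only because the conjugator, which commutes with \<open>S\<close>, is itself block
      diagonal.\<close>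
    obtain Zs where Zs: "length Zs = length ns" "\<And>i. i < length ns \<Longrightarrow> Zs ! i \<in> C i" "Z = diag_block_mat Zs"
      using decomp[OF Z] by blast
    have UC: "U ! i \<in> C i" and UC': "U' ! i \<in> C i" if "i < length ns" for i
      using subsetD[OF reps_i(1)[OF that] U(2)[OF that]] subsetD[OF reps_i(1)[OF that] U'(2)[OF that]] by simp_all
    have bl: "blocks ns U" "blocks ns U'" "blocks ns Zs"
      using blocksI[OF U(1) UC] blocksI[OF U'(1) UC'] blocksI[OF Zs(1,2)] by simp_all
    have eq_i: "Zs ! i * U ! i = U' ! i * Zs ! i" if "i < length ns" for i
      using eq that unfolding U(3) U'(3) Zs(3) diag_block_mat_intertwine_iff[OF bl(3,1,2,3)] by simp
    have "U ! i = U' ! i" if "i < length ns" for i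
      by (rule reps_i(3)[OF that U(2)[OF that] U'(2)[OF that] Zs(2)[OF that] eq_i[OF that]])
    then show "V = V'" using U U' nth_equalityI[of U U'] by simp
  qed
qed

text \<open>A fibre argument: sending a class to the class of its semisimple part has, over the
  class of \<open>(S, B)\<close>, the unipotent classes of the centralizer of \<open>S\<close> as
  its fibre. The family \<open>V\<close> is arbitrary, which keeps the block structure out of this
  step.\<close>

lemma complete_pair_reps_mult_unipotent:
  fixes B\<^sub>0 :: "'a::{field,finite} mat"
  assumes card: "CARD('a) = (if \<kappa> = Hermitian then q\<^sup>2 else q)"
    and B\<^sub>0: "B\<^sub>0 \<in> carrier_mat n n"
    and R: "complete_pair_reps \<kappa> q B\<^sub>0 semisimple R"
    and V: "\<And>S B. (S, B) \<in> R \<Longrightarrow> unipotent_class_reps (centralizer (isom_group \<kappa> q B) S) (V S B)"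
  shows "complete_pair_reps \<kappa> q B\<^sub>0 (\<lambda>X. True) {(S * U, B) | S U B. (S, B) \<in> R \<and> U \<in> V S B}"
    (is "complete_pair_reps _ _ _ _ ?T")
proof -
  let ?G = "isom_group \<kappa> q B\<^sub>0"
  note mc = monoid.m_closed[OF group.is_monoid[OF group_GL], simplified]
  have G: "subgroup ?G (GL n)" using subgroup_isom_group[of \<kappa> q B\<^sub>0] B\<^sub>0 by simp
  have RF: "R \<subseteq> form_pairs \<kappa> q B\<^sub>0" and inj: "inj_on (pair_class \<kappa> q B\<^sub>0) R"
    and img: "pair_class \<kappa> q B\<^sub>0 ` R = {conj_class ?G X | X. X \<in> ?G \<and> semisimple X}"
    using R unfolding complete_pair_reps_def bij_betw_def by blast+
  have Bc: "B \<in> carrier_mat n n" and S: "S \<in> isom_group \<kappa> q B" if "(S, B) \<in> R" for S B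
    using RF that B\<^sub>0 by (auto simp: form_pairs_def congruent_via_def)
  have SG: "S \<in> carrier (GL n)" if "(S, B) \<in> R" for S B
    using isom_group_carrier[OF Bc[OF that] S[OF that]] .
  \<comment> \<open>The representatives are only known to name classes of semisimple elements, so
    semisimplicity is carried over to \<open>S\<close> along an intertwining isometry.\<close>
  have ss: "semisimple S" if r: "(S, B) \<in> R" for S B
  proof -
    obtain X where X: "X \<in> ?G" "semisimple X" "pair_class \<kappa> q B\<^sub>0 (S, B) = conj_class ?G X"
      using img r by blast
    then obtain Q where Q: "Q \<in> isometries \<kappa> q B\<^sub>0 B" "Q * X = S * Q"
      using pair_class_eq_iff[OF card B\<^sub>0 _ X(1), of S B] RF r by blast
    have QG: "Q \<in> carrier (GL n)" using isometries_carrier[OF B\<^sub>0 Q(1)] .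
    have XG: "X \<in> carrier (GL n)" using isom_group_carrier[OF B\<^sub>0 X(1)] .
    have "mat_inv Q * S = X * mat_inv Q"
      using intertwine_mat_inv[OF QG _ _ Q(2)] SG[OF r] XG GL_carrier_mat by blast
    then show ?thesis using semisimple_conj[OF XG SG[OF r] mat_inv_GL(1)[OF QG] _ X(2)] by blast
  qed
  have H: "subgroup (centralizer (isom_group \<kappa> q B) S) (GL n)" if "(S, B) \<in> R" for S B
    using subgroup_centralizer[OF _ GL_carrier_mat[OF SG[OF that]]] subgroup_isom_group[of \<kappa> q B] Bc[OF that]
    by simp
  have V': "V S B \<subseteq> {X \<in> centralizer (isom_group \<kappa> q B) S. unipotent X}"
      "\<And>X. X \<in> centralizer (isom_group \<kappa> q B) S \<Longrightarrow> unipotent X \<Longrightarrow>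
        \<exists>U\<in>V S B. \<exists>Z\<in>centralizer (isom_group \<kappa> q B) S. Z * X = U * Z"
      "\<And>U U' Z. U \<in> V S B \<Longrightarrow> U' \<in> V S B \<Longrightarrow> Z \<in> centralizer (isom_group \<kappa> q B) S \<Longrightarrow>
        Z * U = U' * Z \<Longrightarrow> U = U'"
    if "(S, B) \<in> R" for S B
    using V[OF that] unfolding unipotent_class_reps_iff[OF H[OF that]] by blast+
  have U: "U \<in> isom_group \<kappa> q B" "U \<in> carrier (GL n)" "unipotent U" "S * U = U * S"
    if "(S, B) \<in> R" "U \<in> V S B" for S B U
    using V'(1)[OF that(1)] that(2) isom_group_carrier[OF Bc[OF that(1)]] by (auto simp: centralizer_def)
  have TF: "(S * U, B) \<in> form_pairs \<kappa> q B\<^sub>0" if "(S, B) \<in> R" "U \<in> V S B" for S U B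
  proof -
    have "S * U \<in> isom_group \<kappa> q B"
      using S[OF that(1)] U(1)[OF that] isometries_mult[of U \<kappa> q B B S B] by (simp add: isom_group_eq)
    then show ?thesis using RF that(1) by (auto simp: form_pairs_def)
  qed
  have inj': "S = S' \<and> U = U' \<and> B = B'"
    if r: "(S, B) \<in> R" "(S', B') \<in> R" and v: "U \<in> V S B" "U' \<in> V S' B'"
      and eq: "pair_class \<kappa> q B\<^sub>0 (S * U, B) = pair_class \<kappa> q B\<^sub>0 (S' * U', B')" for S U B S' U' B'
  proof -
    \<comment> \<open>Both pairs are compared with one element \<open>Y\<close> of their common
      class: its two parts are carried by \<open>Q\<close> to \<open>S\<close> and \<open>U\<close>,
      and by \<open>Q'\<close> to \<open>S'\<close> and \<open>U'\<close>.\<close>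
    obtain Y where Y: "Y \<in> ?G" "pair_class \<kappa> q B\<^sub>0 (S * U, B) = conj_class ?G Y"
      using pair_class_conj_class[OF card B\<^sub>0 TF[OF r(1) v(1)]] .
    obtain S0 U0 where Y0: "S0 \<in> ?G" "U0 \<in> ?G" "semisimple S0" "unipotent U0" "S0 * U0 = Y" "S0 * U0 = U0 * S0"
      using jordan_decomposition_exists[OF G Y(1)] .
    have G0: "S0 \<in> carrier (GL n)" "U0 \<in> carrier (GL n)" using Y0(1,2) isom_group_carrier[OF B\<^sub>0] by blast+
    obtain Q where Q: "Q \<in> isometries \<kappa> q B\<^sub>0 B" "Q * Y = S * U * Q"
      using Y(2) pair_class_eq_iff[OF card B\<^sub>0 TF[OF r(1) v(1)] Y(1)] by blast
    obtain Q' where Q': "Q' \<in> isometries \<kappa> q B\<^sub>0 B'" "Q' * Y = S' * U' * Q'"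
      using Y(2) eq pair_class_eq_iff[OF card B\<^sub>0 TF[OF r(2) v(2)] Y(1)] by auto
    have QG: "Q \<in> carrier (GL n)" and Q'G: "Q' \<in> carrier (GL n)"
      using isometries_carrier[OF B\<^sub>0] Q(1) Q'(1) by blast+
    have QSU: "Q * S0 = S * Q" "Q * U0 = U * Q"
      using jordan_decomposition_transport[OF QG _ Y0(6) U(4)[OF r(1) v(1)] Y0(3) ss[OF r(1)] Y0(4) U(3)[OF r(1) v(1)]]
        G0 SG[OF r(1)] U(2)[OF r(1) v(1)] Q(2) Y0(5) by auto
    have QSU': "Q' * S0 = S' * Q'" "Q' * U0 = U' * Q'"
      using jordan_decomposition_transport[OF Q'G _ Y0(6) U(4)[OF r(2) v(2)] Y0(3) ss[OF r(2)] Y0(4) U(3)[OF r(2) v(2)]]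
        G0 SG[OF r(2)] U(2)[OF r(2) v(2)] Q'(2) Y0(5) by auto
    have "pair_class \<kappa> q B\<^sub>0 (S, B) = conj_class ?G S0" "pair_class \<kappa> q B\<^sub>0 (S', B') = conj_class ?G S0"
      using pair_class_eq_iff[OF card B\<^sub>0 _ Y0(1)] r RF Q(1) Q'(1) QSU(1) QSU'(1) by blast+
    then have SB: "S = S'" "B = B'" using inj r unfolding inj_on_def by blast+
    have c: "Q \<in> carrier_mat n n" "mat_inv Q \<in> carrier_mat n n" "Q' \<in> carrier_mat n n"
      "S0 \<in> carrier_mat n n" "U0 \<in> carrier_mat n n" "S \<in> carrier_mat n n" "U \<in> carrier_mat n n" "U' \<in> carrier_mat n n"
      using QG mat_inv_GL(1)[OF QG] Q'G G0 SG[OF r(1)] U(2)[OF r(1) v(1)] U(2)[OF r(2) v(2)] GL_carrier_mat by blast+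
    \<comment> \<open>Going back along \<open>Q\<close> and forward along \<open>Q'\<close>. Because
      the semisimple pairs already agree, this map is an isometry of one form \<open>B\<close> and
      commutes with \<open>S\<close>, so it conjugates within the centralizer.\<close>
    let ?W = "Q' * mat_inv Q"
    have "?W * S = S * ?W" "?W * U = U' * ?W"
      using intertwine_trans[OF _ QSU'(1) intertwine_mat_inv[OF QG c(6,4) QSU(1)], of n]
        intertwine_trans[OF _ QSU'(2) intertwine_mat_inv[OF QG c(7,5) QSU(2)], of n] c SB(1) by simp_all
    moreover have "?W \<in> isom_group \<kappa> q B"
    proof -
      have dim: "dim_row B = dim_row B\<^sub>0" using Bc[OF r(1)] B\<^sub>0 by simp
      have "?W \<in> isometries \<kappa> q B B'"
        by (rule isometries_mult[OF isometries_inv[OF Q(1) dim] Q'(1) dim[symmetric]])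
      then show ?thesis unfolding isom_group_eq SB(2)[symmetric] .
    qed
    ultimately have "?W \<in> centralizer (isom_group \<kappa> q B) S" "?W * U = U' * ?W"
      by (simp_all add: centralizer_def)
    then have "U = U'" using V'(3)[OF r(1) v(1)] v(2)[folded SB] by blast
    then show ?thesis using SB by simp
  qed
  have surj: "\<exists>t\<in>?T. pair_class \<kappa> q B\<^sub>0 t = conj_class ?G Y" if Y: "Y \<in> ?G" for Y
  proof -
    obtain S0 U0 where Y0: "S0 \<in> ?G" "U0 \<in> ?G" "semisimple S0" "unipotent U0" "S0 * U0 = Y" "S0 * U0 = U0 * S0"
      using jordan_decomposition_exists[OF G Y] .
    have "conj_class ?G S0 \<in> pair_class \<kappa> q B\<^sub>0 ` R" unfolding img using Y0(1,3) by blast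
    then obtain S B where r: "(S, B) \<in> R" "pair_class \<kappa> q B\<^sub>0 (S, B) = conj_class ?G S0" by auto
    then obtain Q where Q: "Q \<in> isometries \<kappa> q B\<^sub>0 B" "Q * S0 = S * Q"
      using pair_class_eq_iff[OF card B\<^sub>0 _ Y0(1), of S B] RF by blast
    have QG: "Q \<in> carrier (GL n)" using isometries_carrier[OF B\<^sub>0 Q(1)] .
    have dim: "dim_row B = dim_row B\<^sub>0" using Bc[OF r(1)] B\<^sub>0 by simp
    have G0: "S0 \<in> carrier (GL n)" "U0 \<in> carrier (GL n)" using Y0(1,2) isom_group_carrier[OF B\<^sub>0] by blast+
    have c: "Q \<in> carrier_mat n n" "mat_inv Q \<in> carrier_mat n n"
      "S0 \<in> carrier_mat n n" "U0 \<in> carrier_mat n n" "S \<in> carrier_mat n n"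
      using QG mat_inv_GL(1)[OF QG] G0 SG[OF r(1)] GL_carrier_mat by blast+
    \<comment> \<open>The unipotent part is moved by the isometry that already takes
      \<open>S0\<close> to \<open>S\<close>, so it lands in the centralizer of
      \<open>S\<close>.\<close>
    let ?U = "Q * U0 * mat_inv Q"
    have Uc: "?U \<in> carrier_mat n n" using c by auto
    have UG: "?U \<in> carrier (GL n)" using mc QG G0(2) mat_inv_GL(1)[OF QG] by blast
    have QU: "Q * U0 = ?U * Q" using GL_intertwine_cancel(2)[OF QG c(4)] by simp
    note inv = intertwine_mat_inv[OF QG c(5,3) Q(2)] intertwine_mat_inv[OF QG Uc c(4) QU]
    have "unipotent ?U" using unipotent_conj[OF G0(2) UG mat_inv_GL(1)[OF QG] inv(2) Y0(4)] .
    moreover have "?U \<in> isom_group \<kappa> q B"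
    proof -
      have QU0: "Q * U0 \<in> isometries \<kappa> q B\<^sub>0 B"
        by (rule isometries_mult[OF Y0(2)[unfolded isom_group_eq] Q(1) refl])
      show ?thesis
        unfolding isom_group_eq by (rule isometries_mult[OF isometries_inv[OF Q(1) dim] QU0 dim[symmetric]])
    qed
    moreover have "?U * S = S * ?U"
    proof -
      have U0S0: "U0 * S0 = S0 * U0" using Y0(6) by simp
      have QUS: "(Q * U0) * S0 = S * (Q * U0)" using intertwine_trans[OF _ Q(2) U0S0, of n] c by simp
      have "Q * U0 \<in> carrier_mat n n" using c by simp
      then show ?thesis using intertwine_trans[OF _ QUS inv(1), of n] c by simp
    qed
    ultimately have UH: "?U \<in> centralizer (isom_group \<kappa> q B) S" "unipotent ?U" by (simp_all add: centralizer_def)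
    \<comment> \<open>Passing to the chosen representative costs a further factor \<open>W\<close>,
      which commutes with \<open>S\<close>; hence \<open>W * Q\<close> still takes \<open>S0\<close>
      to \<open>S\<close> and now takes \<open>U0\<close> to \<open>U1\<close>.\<close>
    obtain U1 W where UW: "U1 \<in> V S B" "W \<in> centralizer (isom_group \<kappa> q B) S" "W * ?U = U1 * W"
      using V'(2)[OF r(1) UH] by blast
    have WS: "W * S = S * W" and WI: "W \<in> isom_group \<kappa> q B" using UW(2) by (simp_all add: centralizer_def)
    have c': "W \<in> carrier_mat n n" "U1 \<in> carrier_mat n n"
      using isom_group_carrier[OF Bc[OF r(1)] WI] U(2)[OF r(1) UW(1)] GL_carrier_mat by blast+
    have "(W * Q) * S0 = S * (W * Q)" "(W * Q) * U0 = U1 * (W * Q)"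
      using intertwine_trans[OF _ WS Q(2), of n] intertwine_trans[OF _ UW(3) QU, of n] c c' Uc by simp_all
    then have WQY: "(W * Q) * Y = S * U1 * (W * Q)"
      unfolding Y0(5)[symmetric] using intertwine_mult[of "W * Q" S0 U0 S U1 n] c c' by simp
    have WQ: "W * Q \<in> isometries \<kappa> q B\<^sub>0 B"
      by (rule isometries_mult[OF Q(1) WI[unfolded isom_group_eq] dim])
    have "pair_class \<kappa> q B\<^sub>0 (S * U1, B) = conj_class ?G Y"
      by (rule iffD2[OF pair_class_eq_iff[OF card B\<^sub>0 TF[OF r(1) UW(1)] Y]]) (rule bexI, rule WQY, rule WQ)
    then show ?thesis using r(1) UW(1) by blast
  qed
  have "inj_on (pair_class \<kappa> q B\<^sub>0) ?T"
  proof (rule inj_onI)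
    fix t t' assume "t \<in> ?T" "t' \<in> ?T" and eq: "pair_class \<kappa> q B\<^sub>0 t = pair_class \<kappa> q B\<^sub>0 t'"
    then obtain S U B S' U' B' where t: "(S, B) \<in> R" "U \<in> V S B" "t = (S * U, B)"
      and t': "(S', B') \<in> R" "U' \<in> V S' B'" "t' = (S' * U', B')" by auto
    have "S = S' \<and> U = U' \<and> B = B'"
      by (rule inj'[OF t(1) t'(1) t(2) t'(2) eq[unfolded t(3) t'(3)]])
    then show "t = t'" unfolding t(3) t'(3) by simp
  qed
  moreover have "pair_class \<kappa> q B\<^sub>0 ` ?T = {conj_class ?G X | X. X \<in> ?G \<and> True}"
  proof (intro equalityI subsetI)
    fix K assume "K \<in> pair_class \<kappa> q B\<^sub>0 ` ?T"
    then obtain S U B where K: "(S, B) \<in> R" "U \<in> V S B" "K = pair_class \<kappa> q B\<^sub>0 (S * U, B)" by auto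
    obtain Y where "Y \<in> ?G" "pair_class \<kappa> q B\<^sub>0 (S * U, B) = conj_class ?G Y"
      using pair_class_conj_class[OF card B\<^sub>0 TF[OF K(1,2)]] .
    then show "K \<in> {conj_class ?G X | X. X \<in> ?G \<and> True}" unfolding K(3) by auto
  next
    fix K assume "K \<in> {conj_class ?G X | X. X \<in> ?G \<and> True}"
    then obtain Y where Y: "Y \<in> ?G" "K = conj_class ?G Y" by auto
    obtain t where t: "t \<in> ?T" "pair_class \<kappa> q B\<^sub>0 t = conj_class ?G Y" using surj[OF Y(1)] by (elim bexE)
    show "K \<in> pair_class \<kappa> q B\<^sub>0 ` ?T" unfolding Y(2) t(2)[symmetric] using t(1) by (rule imageI)
  qed
  moreover have "?T \<subseteq> form_pairs \<kappa> q B\<^sub>0" using TF by auto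
  ultimately show ?thesis unfolding complete_pair_reps_def bij_betw_def by (intro conjI)
qed

theorem theorem6p1p5:
  fixes \<kappa> :: form_type and q n :: nat
    and B\<^sub>0 :: "'a::{field, finite} mat"
    and R :: "('a mat \<times> 'a mat) set"
    and Ss Bs :: "'a mat \<times> 'a mat \<Rightarrow> 'a mat list"
    and Us :: "'a mat \<times> 'a mat \<Rightarrow> nat \<Rightarrow> 'a mat set"
  assumes "CARD('a) = (if \<kappa> = Hermitian then q\<^sup>2 else q)"
    and "classical_form \<kappa> q n B\<^sub>0"
    and "complete_pair_reps \<kappa> q B\<^sub>0 semisimple R"
    and "\<And>r. r \<in> R \<Longrightarrow> adapted_blocks \<kappa> q r (Ss r) (Bs r)"
    and "\<And>r i. r \<in> R \<Longrightarrow> i < length (Ss r) \<Longrightarrow>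
           unipotent_class_reps (centralizer (isom_group \<kappa> q (Bs r ! i)) (Ss r ! i)) (Us r i)"
  shows "complete_pair_reps \<kappa> q B\<^sub>0 (\<lambda>X. True)
           {(diag_block_mat (Ss r) * diag_block_mat U, diag_block_mat (Bs r)) | r U.
              r \<in> R \<and> length U = length (Ss r) \<and> (\<forall>i<length U. U ! i \<in> Us r i)}"
proof -
  define V where "V S B = diag_block_mat `
    {U. length U = length (Ss (S, B)) \<and> (\<forall>i<length U. U ! i \<in> Us (S, B) i)}" for S B
  have B\<^sub>0: "B\<^sub>0 \<in> carrier_mat n n" using assms(2) by (simp add: classical_form_def)
  have "unipotent_class_reps (centralizer (isom_group \<kappa> q B) S) (V S B)" if "(S, B) \<in> R" for S B
    unfolding V_def by (rule unipotent_class_reps_diag_block_mat[OF assms(4)[OF that] assms(5)[OF that]])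
  from complete_pair_reps_mult_unipotent[OF assms(1) B\<^sub>0 assms(3) this]
  have "complete_pair_reps \<kappa> q B\<^sub>0 (\<lambda>X. True) {(S * U, B) | S U B. (S, B) \<in> R \<and> U \<in> V S B}" .
  moreover have diag: "S = diag_block_mat (Ss (S, B)) \<and> B = diag_block_mat (Bs (S, B))" if "(S, B) \<in> R" for S B
    using assms(4)[OF that] unfolding adapted_blocks_def prod.case by (elim conjE) (rule conjI)
  have "{(diag_block_mat (Ss r) * diag_block_mat U, diag_block_mat (Bs r)) | r U.
      r \<in> R \<and> length U = length (Ss r) \<and> (\<forall>i<length U. U ! i \<in> Us r i)} =
    {(S * U, B) | S U B. (S, B) \<in> R \<and> U \<in> V S B}" (is "?L = ?T")
  proof (intro equalityI subsetI)
    fix t assume "t \<in> ?L"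
    then obtain S B U where "(S, B) \<in> R" "length U = length (Ss (S, B))" "\<forall>i<length U. U ! i \<in> Us (S, B) i"
      "t = (diag_block_mat (Ss (S, B)) * diag_block_mat U, diag_block_mat (Bs (S, B)))" by auto
    moreover from this have "t = (S * diag_block_mat U, B)" using diag[of S B] by simp
    ultimately show "t \<in> ?T" unfolding V_def by blast
  next
    fix t assume "t \<in> ?T"
    then obtain S B U where *: "(S, B) \<in> R" "length U = length (Ss (S, B))" "\<forall>i<length U. U ! i \<in> Us (S, B) i"
      "t = (S * diag_block_mat U, B)" unfolding V_def by blast
    then have "t = (diag_block_mat (Ss (S, B)) * diag_block_mat U, diag_block_mat (Bs (S, B)))"
      using diag[of S B] by simp
    then show "t \<in> ?L" using * by blast
  qed
  ultimately show ?thesis by simp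
qed

end
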